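(* Let $0<\xi<1$ and let $(X_n,n\ge 1)$ be i.i.d. random variables with distribution function $F$ satisfying $\bar F\in RV_{-1/\xi}$. Let $k=k_n$ be a sequence of positive integers with $k_n\to\infty$ and $k_n/n\to 0$ as $n\to\infty$. For each $n$ let $X_{(1)}\ge X_{(2)}\ge\cdots\ge X_{(n)}$ be the order statistics of $X_1,\dots,X_n$ and let $\hat M$ be the empirical mean excess function of $X_1,\dots,X_n$. Then, as $n\to\infty$, $$\mathcal{S}_n:=\frac{1}{X_{(k)}}\Big\{\big(X_{(i)},\hat M(X_{(i)})\big): i=2,\ldots,k\Big\}\ \stackrel{P}{\longrightarrow}\ \mathcal{S}:=\Big\{\Big(t,\frac{\xi}{1-\xi}\,t\Big): t\ge 1\Big\}$$ in $\mathcal{F}$, the space of closed subsets of $\mathbb{R}^2$ with the Fell topology.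
   Context: Write $\bar F(x)=1-F(x)$. A function $U:(0,\infty)\to\mathbb{R}_+$ is regularly varying with index $\rho\in\mathbb{R}$, written $U\in RV_\rho$, if $\lim_{t\to\infty}U(tx)/U(t)=x^\rho$ for all $x>0$. The empirical mean excess function of the sample $X_1,\dots,X_n$ is $$\hat M(u)=\frac{\sum_{j=1}^n (X_j-u)I_{[X_j>u]}}{\sum_{j=1}^n I_{[X_j>u]}},$$ with the value $0$ when the denominator is $0$. It depends on $n$. For a real number $x$ and a set $A\subset\mathbb{R}^2$, $xA=\{xy:y\in A\}$. $\mathcal{F}$ denotes the collection of closed subsets of $\mathbb{R}^2$ with the Fell topology, generated by the families $\{F\in\mathcal{F}:F\cap K=\emptyset\}$ ($K$ compact) and $\{F\in\mathcal{F}:F\cap G\ne\emptyset\}$ ($G$ open). This topology is metrizable, and $\stackrel{P}{\longrightarrow}$ in $\mathcal{F}$ denotes convergence in probability of random closed sets with respect to such a metric. Equivalently, every subsequence has a further subsequence along which the sets converge almost surely in the Fell topology. *)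

theory Defs
  imports "HOL-Probability.Probability"
begin

definition regularly_varying :: "(real \<Rightarrow> real) \<Rightarrow> real \<Rightarrow> bool" where
  "regularly_varying U \<rho> \<longleftrightarrow>
     (\<forall>t>0. 0 \<le> U t) \<and> (\<forall>x>0. ((\<lambda>t. U (t * x) / U t) \<longlongrightarrow> x powr \<rho>) at_top)"

text \<open>
  A sample of size \<open>n\<close> is given by the values \<open>x 1, \<dots>, x n\<close>. The order statistics are
  numbered from 1 in decreasing order; they are meaningful for \<open>1 \<le> i \<le> n\<close> only.
\<close>

definition order_stat :: "(nat \<Rightarrow> real) \<Rightarrow> nat \<Rightarrow> nat \<Rightarrow> real" where
  "order_stat x n i = rev (sort (map x [1..<Suc n])) ! (i - 1)"

definition mean_excess :: "(nat \<Rightarrow> real) \<Rightarrow> nat \<Rightarrow> real \<Rightarrow> real" where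
  "mean_excess x n u =
     (let N = (\<Sum>j=1..n. indicator {u<..} (x j))
      in if N = 0 then 0 else (\<Sum>j=1..n. (x j - u) * indicator {u<..} (x j)) / N)"

definition fell_topology :: "'a::topological_space set topology" where
  "fell_topology = topology_generated_by
     ({{F. closed F \<and> F \<inter> K = {}} | K. compact K} \<union>
      {{F. closed F \<and> F \<inter> G \<noteq> {}} | G. open G})"

lemma topspace_fell_topology:
  "topspace (fell_topology :: 'a::topological_space set topology) = {F. closed F}"
proof (rule subset_antisym)
  show "topspace (fell_topology :: 'a set topology) \<subseteq> {F. closed F}"
    unfolding fell_topology_def topology_generated_by_topspace by (rule Union_least) auto
  have "{F :: 'a set. closed F} \<in> {{F. closed F \<and> F \<inter> K = {}} | K. compact K}"
    by (intro CollectI exI[of _ "{}"]) simp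
  then show "{F. closed F} \<subseteq> topspace (fell_topology :: 'a set topology)"
    unfolding fell_topology_def topology_generated_by_topspace
    by (intro Union_upper UnI1)
qed

definition borel_sigma :: "'b topology \<Rightarrow> 'b measure" where
  "borel_sigma T = sigma (topspace T) {U. openin T U}"

text \<open>
  Convergence in probability of random elements of a metrizable space. For a second
  countable \<open>T\<close>, such as the Fell topology of a Euclidean space, the choice of the metric is
  irrelevant, so the condition is imposed for all compatible metrics; metrizability is
  required explicitly so that this quantification is not vacuous. Measurability is part of the
  notion; without it \<^const>\<open>measure\<close> would assign 0 to non-measurable events.
\<close>

definition converges_in_prob ::
  "'a measure \<Rightarrow> 'b topology \<Rightarrow> (nat \<Rightarrow> 'a \<Rightarrow> 'b) \<Rightarrow> ('a \<Rightarrow> 'b) \<Rightarrow> bool" where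
  "converges_in_prob M T Y Z \<longleftrightarrow>
     (\<forall>n. Y n \<in> measurable M (borel_sigma T)) \<and> Z \<in> measurable M (borel_sigma T) \<and>
     metrizable_space T \<and>
     (\<forall>d. Metric_space (topspace T) d \<and> Metric_space.mtopology (topspace T) d = T \<longrightarrow>
        (\<forall>\<epsilon>>0. (\<lambda>n. measure M {\<omega> \<in> space M. d (Y n \<omega>) (Z \<omega>) > \<epsilon>}) \<longlonglongrightarrow> 0))"

definition mean_excess_plot :: "(nat \<Rightarrow> real) \<Rightarrow> nat \<Rightarrow> nat \<Rightarrow> (real \<times> real) set" where
  "mean_excess_plot x n k =
     (\<lambda>y. (1 / order_stat x n k) *\<^sub>R y) `
       {(order_stat x n i, mean_excess x n (order_stat x n i)) | i. i \<in> {2..k}}"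

end

theory Submission
  imports Defs
begin

text \<open>
  Write \<open>U = 1 - F\<close> and \<open>\<alpha> = 1/\<xi> > 1\<close>, and let \<open>b n\<close> be the quantile of \<open>F\<close> at level
  \<open>1 - k n / n\<close>. Everything about the plot can be read off from two monotone functions of a
  threshold \<open>v\<close>: the number of exceedances \<open>#{j. X j > v}\<close> and the total excess
  \<open>(\<Sum>j. max 0 (X j - v))\<close>. The empirical mean excess is their quotient, and the \<open>i\<close>-th largest
  observation is above \<open>v\<close> exactly when there are at least \<open>i\<close> exceedances
  (\<open>order_stat_greater_iff\<close>).
  
  At the threshold \<open>b n * u\<close>, regular variation makes the expected number of exceedances
  asymptotic to \<open>k n * u powr - \<alpha>\<close>, and since \<open>k n\<close> tends to infinity Chebyshev's inequality gives a
  weak law (\<open>count_ratio_tendsto\<close>). The total excess is the integral of the number of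
  exceedances over all higher thresholds. Riemann sums on a geometric grid therefore carry the weak law over to it,
  with limit \<open>u powr (1 - \<alpha>) / (\<alpha> - 1)\<close>, as soon as the part of the integral beyond a high
  threshold is known to be small (\<open>excess_ratio_tendsto\<close>). This last point is where \<open>\<alpha> > 1\<close>
  enters: the mean is finite, but possibly not the variance, so the tail of the integral is
  controlled by Markov's inequality.
  
  Dividing, the mean excess at \<open>b n * u\<close> is close to \<open>b n * u / (\<alpha> - 1)\<close>, and the threshold
  \<open>X\<^sub>(\<^sub>k\<^sub>)\<close> is close to \<open>b n\<close>. Because both functions are monotone, two nearby thresholds control all
  intermediate ones, including the random thresholds at which the plot evaluates them
  (\<open>plot_points_near_line\<close>). Hence the plot eventually misses a neighbourhood of every point off the
  line and hits every open set that meets the line, which by the definition of the Fell topology is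
  convergence to the line (\<open>plot_in_fell_neighbourhood\<close>).
  
  Statements of the form ``with probability tending to one'' are expressed by a filter on pairs of a
  sample size and an outcome (\<open>whp\<close>), so that convergence in probability to a constant becomes an
  ordinary limit along this filter. Two topological facts complete the proof: the Fell topology is metrizable
  (\<open>metrizable_fell_topology\<close>) and finite random sets are measurable for it
  (\<open>measurable_finite_random_set\<close>).
\<close>

section \<open>Metrizability of the Fell topology\<close>

text \<open>
  The value 1 at the empty set is the limit of the truncated distance to a set that escapes to
  infinity. Without the truncation the empty set would need an infinite value.
\<close>

definition fell_dist :: "'a::metric_space \<Rightarrow> 'a set \<Rightarrow> real" where
  "fell_dist q F = (if F = {} then 1 else min 1 (infdist q F))"

text \<open>
  The sub- and superlevel sets of the truncated distance are hit sets of open balls and miss sets of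
  closed balls, that is, subbasic open sets of the Fell topology. The second equivalence needs the
  distance to be attained, hence closed sets in a space with compact balls.
\<close>

lemma fell_dist_less_iff:
  assumes "a \<le> 1" shows "fell_dist q F < a \<longleftrightarrow> F \<inter> ball q a \<noteq> {}"
proof (cases "F = {}")
  case False
  have "infdist q F < a \<longleftrightarrow> (\<exists>x\<in>F. dist q x < a)"
    using False by (auto simp: infdist_notempty cINF_less_iff)
  then show ?thesis
    using False assms unfolding fell_dist_def by (auto simp: min_less_iff_disj ball_def)
qed (use assms in \<open>auto simp: fell_dist_def\<close>)

lemma fell_dist_greater_iff:
  fixes q :: "'a::heine_borel"
  assumes "closed F" "a < 1" shows "a < fell_dist q F \<longleftrightarrow> F \<inter> cball q a = {}"
proof (cases "F = {}")
  case False
  obtain x where x: "x \<in> F" "infdist q F = dist q x"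
    using infdist_attains_inf[OF assms(1) False] by metis
  have "a < infdist q F \<longleftrightarrow> (\<forall>y\<in>F. a < dist q y)"
    using x infdist_le[of _ F q] by (metis order_less_le_trans)
  then show ?thesis
    using False assms unfolding fell_dist_def by (auto simp: not_le[symmetric])
qed (use assms in \<open>auto simp: fell_dist_def\<close>)

lemma openin_fell_hit: "open G \<Longrightarrow> openin fell_topology {F. closed F \<and> F \<inter> G \<noteq> {}}"
  unfolding fell_topology_def by (rule topology_generated_by_Basis) auto

lemma openin_fell_miss: "compact K \<Longrightarrow> openin fell_topology {F. closed F \<and> F \<inter> K = {}}"
  unfolding fell_topology_def by (rule topology_generated_by_Basis) auto

lemma continuous_map_fell_dist:
  fixes q :: "'a::heine_borel"
  shows "continuous_map fell_topology euclideanreal (fell_dist q)"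
  unfolding continuous_map_upper_lower_semicontinuous_lt topspace_fell_topology
proof (intro conjI allI)
  fix a :: real
  show "openin fell_topology {F \<in> {F. closed F}. a < fell_dist q F}"
  proof (cases "a < 1")
    case True
    have "{F \<in> {F. closed F}. a < fell_dist q F} = {F. closed F \<and> F \<inter> cball q a = {}}"
      using fell_dist_greater_iff[OF _ True] by auto
    then show ?thesis using openin_fell_miss[of "cball q a"] by simp
  next
    case False
    then have "{F \<in> {F. closed F}. a < fell_dist q F} = {}"
      by (auto simp: fell_dist_def)
    then show ?thesis by (simp only: openin_empty)
  qed
  show "openin fell_topology {F \<in> {F. closed F}. fell_dist q F < a}"
  proof (cases "a \<le> 1")
    case True
    have "{F \<in> {F. closed F}. fell_dist q F < a} = {F. closed F \<and> F \<inter> ball q a \<noteq> {}}"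
      using fell_dist_less_iff[OF True] by auto
    then show ?thesis using openin_fell_hit[of "ball q a"] by simp
  next
    case False
    then have "{F \<in> {F. closed F}. fell_dist q F < a} = topspace fell_topology"
      unfolding topspace_fell_topology by (auto simp: fell_dist_def)
    then show ?thesis by simp
  qed
qed

text \<open>
  The map sending \<open>F\<close> to the family of its truncated distances from the points of a countable dense
  set is an embedding into a countable power of the real line. For openness of the map onto its image it
  suffices that the subbasic sets are unions of finite intersections of sub- and superlevel sets
  of these distances: hitting an open set means hitting a small ball inside it with centre in the
  dense set, and missing a compact set means missing finitely many small closed balls whose open
  counterparts cover it.
\<close>

theorem metrizable_fell_topology:
  "metrizable_space (fell_topology :: 'a::{heine_borel,second_countable_topology} set topology)"
proof -
  obtain Q :: "'a set" where Q: "countable Q" "\<And>G. open G \<Longrightarrow> G \<noteq> {} \<Longrightarrow> \<exists>q\<in>Q. q \<in> G"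
    using countable_dense_exists by metis
  define Y where "Y = (product_topology (\<lambda>_. euclideanreal) Q)"
  define \<Phi> where "\<Phi> = (\<lambda>F. restrict (\<lambda>q::'a. fell_dist q F) Q)"
  \<comment> \<open>the sets open in the topology induced by \<open>\<Phi>\<close>\<close>
  define P where "P = (\<lambda>U. \<exists>V. openin Y V \<and> U = {F. closed F \<and> \<Phi> F \<in> V})"
  have \<Phi>: "\<Phi> F \<in> topspace Y" for F by (auto simp: \<Phi>_def Y_def)
  have P_UN: "P (\<Union>\<U>)" if "\<And>U. U \<in> \<U> \<Longrightarrow> P U" for \<U>
  proof -
    from that obtain V where "\<And>U. U \<in> \<U> \<Longrightarrow> openin Y (V U) \<and> U = {F. closed F \<and> \<Phi> F \<in> V U}"
      unfolding P_def by metis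
    then have "openin Y (\<Union>U\<in>\<U>. V U)" "\<Union>\<U> = {F. closed F \<and> \<Phi> F \<in> (\<Union>U\<in>\<U>. V U)}"
      by blast+
    then show ?thesis unfolding P_def by blast
  qed
  have P_Int: "P (U \<inter> U')" if PU: "P U" "P U'" for U U'
  proof -
    obtain V where V: "openin Y V" "U = {F. closed F \<and> \<Phi> F \<in> V}"
      using PU(1) unfolding P_def by blast
    obtain V' where V': "openin Y V'" "U' = {F. closed F \<and> \<Phi> F \<in> V'}"
      using PU(2) unfolding P_def by blast
    show ?thesis unfolding P_def by (rule exI[of _ "V \<inter> V'"]) (use V V' in auto)
  qed
  have P_top: "P {F. closed F}"
    unfolding P_def by (rule exI[of _ "topspace Y"]) (use \<Phi> in auto)
  have cont: "continuous_map Y euclideanreal (\<lambda>v. v q)" if "q \<in> Q" for q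
    unfolding Y_def by (rule continuous_map_product_projection[OF that])
  have P_less: "P {F. closed F \<and> fell_dist q F < r}" if "q \<in> Q" for q r
    unfolding P_def
    by (rule exI[of _ "{v \<in> topspace Y. v q \<in> {..<r}}"], intro conjI openin_continuous_map_preimage[OF cont[OF that]])
       (use \<Phi> that in \<open>auto simp: \<Phi>_def\<close>)
  have P_greater: "P {F. closed F \<and> fell_dist q F > r}" if "q \<in> Q" for q r
    unfolding P_def
    by (rule exI[of _ "{v \<in> topspace Y. v q \<in> {r<..}}"], intro conjI openin_continuous_map_preimage[OF cont[OF that]])
       (use \<Phi> that in \<open>auto simp: \<Phi>_def\<close>)
  have P_hit: "P {F. closed F \<and> F \<inter> G \<noteq> {}}" if "open G" for G
  proof -
    let ?B = "{(q, r). q \<in> Q \<and> r \<le> 1 \<and> ball q r \<subseteq> G}"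
    have "{F. closed F \<and> F \<inter> G \<noteq> {}} = (\<Union>(q,r)\<in>?B. {F. closed F \<and> fell_dist q F < r})" (is "?L = ?R")
    proof (intro equalityI subsetI)
      fix F assume "F \<in> ?L"
      then obtain x where x: "closed F" "x \<in> F" "x \<in> G" by auto
      obtain e where e: "e > 0" "ball x e \<subseteq> G" using \<open>open G\<close> x(3) openE by blast
      define r where "r = min 1 e / 2"
      have r: "0 < r" "r \<le> 1" "2 * r \<le> e" using e by (auto simp: r_def)
      obtain q where q: "q \<in> Q" "q \<in> ball x r" using Q(2)[of "ball x r"] r by auto
      have "ball q r \<subseteq> G"
      proof
        fix y assume "y \<in> ball q r"
        then have "dist x y < e" using q(2) r(3) dist_triangle[of x y q] by simp
        then show "y \<in> G" using e(2) by auto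
      qed
      moreover have "fell_dist q F < r"
        using q(2) x(2) r by (subst fell_dist_less_iff) (auto simp: dist_commute)
      ultimately show "F \<in> ?R" using q(1) r(2) x(1) by blast
    next
      fix F assume "F \<in> ?R"
      then obtain q r where qr: "closed F" "r \<le> 1" "ball q r \<subseteq> G" "fell_dist q F < r" by blast
      then have "F \<inter> ball q r \<noteq> {}" using fell_dist_less_iff by blast
      then show "F \<in> ?L" using qr by blast
    qed
    moreover have "P ?R" by (rule P_UN) (use P_less in auto)
    ultimately show ?thesis by simp
  qed
  have P_INT: "P ({F. closed F} \<inter> (\<Inter>c\<in>C. {F. closed F \<and> fell_dist (fst c) F > snd c}))"
    if "finite C" "C \<subseteq> Q \<times> UNIV" for C :: "('a \<times> real) set"
    using that
  proof (induction C)
    case (insert c C)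
    have "{F. closed F} \<inter> (\<Inter>c\<in>insert c C. {F. closed F \<and> fell_dist (fst c) F > snd c})
       = {F. closed F \<and> fell_dist (fst c) F > snd c} \<inter>
          ({F. closed F} \<inter> (\<Inter>c\<in>C. {F. closed F \<and> fell_dist (fst c) F > snd c}))" by auto
    with insert P_Int P_greater show ?case by auto
  qed (use P_top in auto)
  have P_miss: "P {F. closed F \<and> F \<inter> K = {}}" if "compact K" for K
  proof -
    let ?B = "{C. finite C \<and> C \<subseteq> Q \<times> {..<1} \<and> K \<subseteq> (\<Union>c\<in>C. ball (fst c) (snd c))}"
    let ?I = "\<lambda>C. {F. closed F} \<inter> (\<Inter>c\<in>C. {F. closed F \<and> fell_dist (fst c) F > snd c})"
    have "{F. closed F \<and> F \<inter> K = {}} = (\<Union>C\<in>?B. ?I C)" (is "?L = ?R")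
    proof (intro equalityI subsetI)
      fix F assume "F \<in> ?L"
      then have F: "closed F" "F \<inter> K = {}" by auto
      have "\<exists>q r. q \<in> Q \<and> r < 1 \<and> x \<in> ball q r \<and> fell_dist q F > r" if "x \<in> K" for x
      proof -
        have "open (- F)" "x \<in> - F" using F that by auto
        then obtain e where e: "e > 0" "ball x e \<subseteq> - F" using openE by blast
        define r where "r = min 1 e / 3"
        have r: "0 < r" "r < 1" "2 * r < e" using e by (auto simp: r_def)
        obtain q where q: "q \<in> Q" "q \<in> ball x r" using Q(2)[of "ball x r"] r by auto
        have "F \<inter> cball q r = {}"
        proof (rule ccontr)
          assume "F \<inter> cball q r \<noteq> {}"
          then obtain y where y: "y \<in> F" "dist q y \<le> r" by auto
          then have "dist x y < e" using q(2) r(3) dist_triangle[of x y q] by simp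
          then show False using e(2) y(1) by auto
        qed
        then show ?thesis
          using q r F(1) fell_dist_greater_iff[OF F(1) r(2)] by (auto simp: dist_commute intro!: exI[of _ q] exI[of _ r])
      qed
      then obtain q r where qr: "\<And>x. x \<in> K \<Longrightarrow> q x \<in> Q \<and> r x < (1::real) \<and> x \<in> ball (q x) (r x) \<and> fell_dist (q x) F > r x"
        by metis
      obtain D where D: "D \<subseteq> K" "finite D" "K \<subseteq> (\<Union>x\<in>D. ball (q x) (r x))"
        using compactE_image[OF \<open>compact K\<close>, of K "\<lambda>x. ball (q x) (r x)"] qr by blast
      let ?C = "(\<lambda>x. (q x, r x)) ` D"
      have "?C \<in> ?B" using D qr by auto
      moreover have "F \<in> ?I ?C" using D qr F(1) by auto
      ultimately show "F \<in> ?R" by blast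
    next
      fix F assume "F \<in> ?R"
      then obtain C where C: "C \<in> ?B" "F \<in> ?I C" by blast
      have "F \<inter> cball (fst c) (snd c) = {}" if "c \<in> C" for c
      proof -
        have "closed F" "snd c < 1" "snd c < fell_dist (fst c) F" using C that by auto
        then show ?thesis using fell_dist_greater_iff by blast
      qed
      then have "F \<inter> K = {}" using C(1) ball_subset_cball by blast
      then show "F \<in> ?L" using C(2) by auto
    qed
    moreover have "P (\<Union>C\<in>?B. ?I C)"
      by (rule P_UN) (use P_INT in blast)
    ultimately show ?thesis by simp
  qed
  have P: "P U" if "openin fell_topology U" for U :: "'a set set"
    using openin_topology_generated_by[OF that[unfolded fell_topology_def]]
  proof (induction U rule: generate_topology_on.induct)
    case Empty show ?case using P_UN[of "{}"] by simp
  qed (use P_Int P_UN P_hit P_miss in blast)+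
  have cm: "continuous_map fell_topology Y \<Phi>"
    unfolding Y_def \<Phi>_def by (rule continuous_map_coordinatewise_then_product)
      (auto intro: continuous_map_eq[OF continuous_map_fell_dist])
  have inj: "inj_on \<Phi> (topspace fell_topology)"
  proof -
    have sub: "F \<subseteq> F'" if F: "closed F" "closed F'" "\<Phi> F = \<Phi> F'" for F F'
    proof -
      have "P {H. closed H \<and> H \<inter> - F' \<noteq> {}}" using F(2) by (intro P_hit) auto
      then obtain V where V: "{H. closed H \<and> H \<inter> - F' \<noteq> {}} = {H. closed H \<and> \<Phi> H \<in> V}"
        unfolding P_def by blast
      have "F' \<notin> {H. closed H \<and> \<Phi> H \<in> V}" unfolding V[symmetric] by simp
      then have "F \<notin> {H. closed H \<and> \<Phi> H \<in> V}" using F by simp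
      then have "F \<notin> {H. closed H \<and> H \<inter> - F' \<noteq> {}}" unfolding V .
      then show ?thesis using F(1) by auto
    qed
    show ?thesis
    proof (rule inj_onI)
      fix F F' assume "F \<in> topspace fell_topology" "F' \<in> topspace fell_topology" "\<Phi> F = \<Phi> F'"
      then show "F = F'"
        using sub[of F F'] sub[of F' F] by (simp add: topspace_fell_topology)
    qed
  qed
  have "embedding_map fell_topology Y \<Phi>"
    unfolding embedding_map_def
  proof (rule bijective_open_imp_homeomorphic_map[OF _ _ _ inj])
    show "continuous_map fell_topology (subtopology Y (\<Phi> ` topspace fell_topology)) \<Phi>"
      using cm by (auto simp: continuous_map_in_subtopology)
    show "\<Phi> ` topspace fell_topology = topspace (subtopology Y (\<Phi> ` topspace fell_topology))"
      using \<Phi> by auto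
    show "open_map fell_topology (subtopology Y (\<Phi> ` topspace fell_topology)) \<Phi>"
      unfolding open_map_def
    proof (intro allI impI)
      fix U :: "'a set set" assume "openin fell_topology U"
      then obtain V where V: "openin Y V" "U = {F. closed F \<and> \<Phi> F \<in> V}" using P P_def by blast
      then have "\<Phi> ` U = V \<inter> \<Phi> ` topspace fell_topology"
        unfolding topspace_fell_topology by auto
      then show "openin (subtopology Y (\<Phi> ` topspace fell_topology)) (\<Phi> ` U)"
        using V(1) unfolding openin_subtopology by blast
    qed
  qed
  then have "(fell_topology :: 'a set topology) homeomorphic_space subtopology Y (\<Phi> ` topspace fell_topology)"
    by (rule embedding_map_imp_homeomorphic_space)
  moreover have "metrizable_space Y"
    unfolding Y_def metrizable_space_product_topology
    using countable_subset[OF _ Q(1), of "{i \<in> Q. \<not> (\<exists>a. topspace euclideanreal \<subseteq> {a})}"] metrizable_space_euclidean by auto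
  ultimately show ?thesis
    using homeomorphic_metrizable_space metrizable_space_subtopology by blast
qed

section \<open>Measurability of finite random sets\<close>

text \<open>
  A finite set depends continuously on the tuple of its points. The preimage of an arbitrary
  Fell-open set is therefore open in the space of tuples, which reduces measurability of a finite
  random set to that of its points.
\<close>

lemma continuous_fell_image:
  fixes I :: "'i set"
  assumes "finite I" and "openin fell_topology (U :: 'a::t2_space set set)"
  shows "open {p :: 'i \<Rightarrow> 'a. p ` I \<in> U}"
  using openin_topology_generated_by[OF assms(2)[unfolded fell_topology_def]]
proof (induction U rule: generate_topology_on.induct)
  case (Int a b)
  then show ?case using open_Int[OF Int.IH] by (simp add: Collect_conj_eq)
next
  case (UN \<U>)
  have "{p :: 'i \<Rightarrow> 'a. p ` I \<in> \<Union>\<U>} = (\<Union>U\<in>\<U>. {p. p ` I \<in> U})" by auto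
  with UN show ?case by auto
next
  case (Basis U)
  have cont: "continuous_on UNIV (\<lambda>p :: 'i \<Rightarrow> 'a. p i)" for i
    by (rule continuous_on_product_coordinates)
  have cl: "closed (p ` I)" for p :: "'i \<Rightarrow> 'a"
    using assms(1) by (intro finite_imp_closed finite_imageI)
  from Basis consider K where "compact K" "U = {F. closed F \<and> F \<inter> K = {}}"
    | G where "open G" "U = {F. closed F \<and> F \<inter> G \<noteq> {}}" by auto
  then show ?case
  proof cases
    case 1
    then have "{p :: 'i \<Rightarrow> 'a. p ` I \<in> U} = (\<Inter>i\<in>I. (\<lambda>p. p i) -` (- K))" using cl by auto
    then show ?thesis using assms(1) 1 compact_imp_closed[OF 1(1)]
      by (auto intro!: open_INT open_vimage cont)
  next
    case 2
    then have "{p :: 'i \<Rightarrow> 'a. p ` I \<in> U} = (\<Union>i\<in>I. (\<lambda>p. p i) -` G)" using cl by auto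
    then show ?thesis using 2 by (auto intro!: open_UN open_vimage cont)
  qed
qed simp

lemma measurable_borel_sigmaI:
  assumes "\<And>\<omega>. \<omega> \<in> space M \<Longrightarrow> f \<omega> \<in> topspace T"
    and "\<And>U. openin T U \<Longrightarrow> f -` U \<inter> space M \<in> sets M"
  shows "f \<in> measurable M (borel_sigma T)"
  unfolding borel_sigma_def
  by (rule measurable_measure_of) (use assms in \<open>auto dest: openin_subset\<close>)

lemma measurable_finite_random_set:
  fixes p :: "'i::countable \<Rightarrow> 'a \<Rightarrow> 'b::{second_countable_topology,t2_space}"
  assumes "finite I" and "\<And>i. i \<in> I \<Longrightarrow> p i \<in> borel_measurable M"
  shows "(\<lambda>\<omega>. (\<lambda>i. p i \<omega>) ` I) \<in> measurable M (borel_sigma fell_topology)"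
proof (rule measurable_borel_sigmaI)
  show "(\<lambda>i. p i \<omega>) ` I \<in> topspace fell_topology" for \<omega>
    using assms(1) by (auto simp: topspace_fell_topology intro!: finite_imp_closed)
  fix U :: "'b set set" assume "openin fell_topology U"
  then have *: "open {q :: 'i \<Rightarrow> 'b. q ` I \<in> U}" by (rule continuous_fell_image[OF assms(1)])
  define q where "q = (\<lambda>\<omega> i. if i \<in> I then p i \<omega> else undefined)"
  have "q \<in> borel_measurable M"
  proof (rule measurable_coordinatewise_then_product)
    show "(\<lambda>\<omega>. q \<omega> i) \<in> borel_measurable M" for i
      using assms(2) by (cases "i \<in> I") (auto simp: q_def)
  qed
  then have "q -` {q. q ` I \<in> U} \<inter> space M \<in> sets M"
    by (rule measurable_sets) (use * in simp)
  moreover have "q \<omega> ` I = (\<lambda>i. p i \<omega>) ` I" for \<omega> by (auto simp: q_def image_def)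
  ultimately show "(\<lambda>\<omega>. (\<lambda>i. p i \<omega>) ` I) -` U \<inter> space M \<in> sets M"
    by (simp add: vimage_def)
qed

section \<open>Regularly varying tails\<close>

lemma regularly_varying_pos:
  assumes "regularly_varying U \<rho>" "antimono U" shows "0 < U t"
proof -
  have "((\<lambda>t. U (t * 2) / U t) \<longlongrightarrow> 2 powr \<rho>) at_top"
    using assms(1) by (simp add: regularly_varying_def)
  then have "\<forall>\<^sub>F s in at_top. 0 < U (s * 2) / U s"
    by (rule order_tendstoD) simp
  then have "\<forall>\<^sub>F s in at_top. s \<ge> max t 1 \<and> 0 < U (s * 2) / U s"
    using eventually_ge_at_top by (rule eventually_conj[rotated])
  then obtain s where s: "s \<ge> max t 1" "0 < U (s * 2) / U s"
    by (auto dest!: eventually_happens'[OF trivial_limit_at_top_linorder])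
  then have "U s \<noteq> 0" "0 \<le> U s"
    using assms(1) by (auto simp: regularly_varying_def)
  moreover have "U s \<le> U t" using s(1) assms(2) by (auto dest: antimonoD)
  ultimately show ?thesis by linarith
qed

definition tail_quantile :: "(real \<Rightarrow> real) \<Rightarrow> real \<Rightarrow> real" where
  "tail_quantile U p = Inf {x. 0 < x \<and> U x \<le> p}"

text \<open>
  \<open>U\<close> may jump over the level \<open>p\<close> at its quantile, so \<open>p\<close> is only bracketed by values of \<open>U\<close> at
  multiples of the quantile slightly above and below it.
\<close>

lemma tail_quantile_bounds:
  assumes "antimono U" "(U \<longlongrightarrow> 0) at_top" "0 < p" and q: "0 < tail_quantile U p"
  shows "1 < s \<Longrightarrow> U (tail_quantile U p * s) \<le> p"
    and "0 < s \<Longrightarrow> s < 1 \<Longrightarrow> p < U (tail_quantile U p * s)"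
proof -
  let ?S = "{x. 0 < x \<and> U x \<le> p}"
  have bdd: "bdd_below ?S" by (rule bdd_belowI[of _ 0]) auto
  have "\<forall>\<^sub>F x in at_top. 0 < x \<and> U x < p"
    using order_tendstoD(2)[OF assms(2,3)] eventually_gt_at_top[of 0] by eventually_elim auto
  then obtain x where "0 < x \<and> U x < p"
    by (auto dest!: eventually_happens'[OF trivial_limit_at_top_linorder])
  then have ne: "?S \<noteq> {}" by (auto intro: less_imp_le)
  show "U (tail_quantile U p * s) \<le> p" if "1 < s"
  proof -
    have "Inf ?S < tail_quantile U p * s"
      using q that by (simp add: tail_quantile_def)
    then obtain x where "x \<in> ?S" "x < tail_quantile U p * s"
      using ne bdd by (auto simp: cInf_less_iff)
    then show ?thesis using antimonoD[OF assms(1), of x "tail_quantile U p * s"] by auto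
  qed
  show "p < U (tail_quantile U p * s)" if "0 < s" "s < 1"
  proof (rule ccontr)
    assume "\<not> ?thesis"
    then have "tail_quantile U p * s \<in> ?S" using q that by auto
    then have "tail_quantile U p \<le> tail_quantile U p * s"
      unfolding tail_quantile_def by (rule cInf_lower[OF _ bdd])
    then show False using q that by simp
  qed
qed

lemma filterlim_tail_quantile:
  assumes "antimono U" "(U \<longlongrightarrow> 0) at_top" "\<And>t. 0 < U t"
    and "(p \<longlongrightarrow> 0) F" "\<forall>\<^sub>F n in F. 0 < p n"
  shows "filterlim (\<lambda>n. tail_quantile U (p n)) at_top F"
  unfolding filterlim_at_top_ge[where c=1]
proof (intro allI impI)
  fix C :: real assume "1 \<le> C"
  have "\<forall>\<^sub>F n in F. p n < U C" by (rule order_tendstoD[OF assms(4)]) (rule assms(3))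
  with assms(5) show "\<forall>\<^sub>F n in F. C \<le> tail_quantile U (p n)"
  proof eventually_elim
    case (elim n)
    have "\<forall>\<^sub>F x in at_top. 0 < x \<and> U x < p n"
      using order_tendstoD(2)[OF assms(2) elim(1)] eventually_gt_at_top[of 0] by eventually_elim auto
    then obtain x where "0 < x \<and> U x < p n"
      by (auto dest!: eventually_happens'[OF trivial_limit_at_top_linorder])
    then have ne: "{x. 0 < x \<and> U x \<le> p n} \<noteq> {}" by (auto intro: less_imp_le)
    show ?case unfolding tail_quantile_def
    proof (rule cInf_greatest[OF ne])
      fix x assume "x \<in> {x. 0 < x \<and> U x \<le> p n}"
      then have "\<not> U C \<le> U x" using elim(2) by auto
      then show "C \<le> x" using antimonoD[OF assms(1), of x C] by (cases "x \<le> C") auto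
    qed
  qed
qed

text \<open>
  By regular variation the bracketing values of \<open>U\<close> at \<open>b * s\<close> for \<open>s\<close> near 1 are asymptotically
  \<open>s powr \<rho>\<close> times \<open>U b\<close>, so letting \<open>s\<close> tend to 1 shows that \<open>p\<close> and \<open>U b\<close> are asymptotically
  equal in spite of the jumps.
\<close>

lemma tail_quantile_asymptotics:
  assumes rv: "regularly_varying U \<rho>" and U: "antimono U" "(U \<longlongrightarrow> 0) at_top"
    and p: "(p \<longlongrightarrow> 0) F" "\<forall>\<^sub>F n in F. 0 < p n" and "0 < s"
  shows "((\<lambda>n. U (tail_quantile U (p n) * s) / p n) \<longlongrightarrow> s powr \<rho>) F"
proof -
  define b where "b = (\<lambda>n. tail_quantile U (p n))"
  have pos: "0 < U t" for t by (rule regularly_varying_pos[OF rv U(1)])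
  have b: "filterlim b at_top F"
    unfolding b_def by (rule filterlim_tail_quantile[OF U pos p])
  have bpos: "\<forall>\<^sub>F n in F. 0 < b n" using b by (auto simp: filterlim_at_top_dense)
  have lim: "((\<lambda>n. U (b n * s) / U (b n)) \<longlongrightarrow> s powr \<rho>) F" if "0 < s" for s
    using filterlim_compose[OF _ b, of "\<lambda>t. U (t * s) / U t"] rv that
    by (simp add: regularly_varying_def)
  have cont: "((\<lambda>s::real. s powr \<rho>) \<longlongrightarrow> 1) (at 1 within S)" for S
    by (rule tendsto_eq_intros | simp)+
  have "((\<lambda>n. p n / U (b n)) \<longlongrightarrow> 1) F"
  proof (rule order_tendstoI)
    fix a :: real assume "a < 1"
    then have "\<forall>\<^sub>F s in at_right (1::real). 1 < s \<and> a < s powr \<rho>"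
      using order_tendstoD(1)[OF cont] eventually_at_right_less[of "1::real"] by (auto intro: eventually_conj)
    then obtain s :: real where s: "1 < s" "a < s powr \<rho>"
      by (auto dest!: eventually_happens'[rotated])
    have "\<forall>\<^sub>F n in F. a < U (b n * s) / U (b n)"
      by (rule order_tendstoD[OF lim]) (use s in auto)
    with bpos p(2) show "\<forall>\<^sub>F n in F. a < p n / U (b n)"
    proof eventually_elim
      case (elim n)
      have "U (b n * s) \<le> p n"
        unfolding b_def by (rule tail_quantile_bounds[OF U]) (use elim s in \<open>auto simp: b_def\<close>)
      then have "U (b n * s) / U (b n) \<le> p n / U (b n)" by (simp add: divide_right_mono less_imp_le pos)
      with elim show ?case by linarith
    qed
  next
    fix a :: real assume "1 < a"
    have "\<forall>\<^sub>F s in at_left (1::real). 0 < s" by (rule eventually_at_leftI[of 0]) auto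
    moreover have "\<forall>\<^sub>F s in at_left (1::real). s < 1" by (rule eventually_at_leftI[of 0]) auto
    ultimately have "\<forall>\<^sub>F s in at_left (1::real). 0 < s \<and> s < 1 \<and> s powr \<rho> < a"
      using order_tendstoD(2)[OF cont \<open>1 < a\<close>, of "{..<1}"] by eventually_elim auto
    then obtain s :: real where s: "0 < s" "s < 1" "s powr \<rho> < a"
      by (auto dest!: eventually_happens'[rotated])
    have "\<forall>\<^sub>F n in F. U (b n * s) / U (b n) < a"
      by (rule order_tendstoD[OF lim]) (use s in auto)
    with bpos p(2) show "\<forall>\<^sub>F n in F. p n / U (b n) < a"
    proof eventually_elim
      case (elim n)
      have "p n < U (b n * s)"
        unfolding b_def by (rule tail_quantile_bounds[OF U]) (use elim s in \<open>auto simp: b_def\<close>)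
      then have "p n / U (b n) < U (b n * s) / U (b n)" by (simp add: divide_strict_right_mono pos)
      with elim show ?case by linarith
    qed
  qed
  then have "((\<lambda>n. (U (b n * s) / U (b n)) / (p n / U (b n))) \<longlongrightarrow> s powr \<rho> / 1) F"
    by (intro tendsto_divide lim \<open>0 < s\<close>) simp_all
  moreover have "(U (b n * s) / U (b n)) / (p n / U (b n)) = U (b n * s) / p n" for n
    using pos[of "b n"] by (simp add: less_imp_neq[symmetric])
  ultimately show ?thesis unfolding b_def by (simp only: div_by_1)
qed

text \<open>
  This plays the role of Karamata's theorem, that the integral of \<open>U\<close> from \<open>t\<close> to infinity is of order
  \<open>t * U t\<close>. For \<open>\<rho> < -1\<close>, doubling a large argument multiplies \<open>U\<close> by at most some \<open>q < 1/2\<close>, so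
  the sum is dominated by a geometric series of ratio \<open>2 * q\<close>.
\<close>

lemma dyadic_tail_sum:
  assumes rv: "regularly_varying U \<rho>" and U: "antimono U" and "\<rho> < -1"
  obtains C t0 :: real where "0 < C" "0 < t0"
    "\<And>t. t0 \<le> t \<Longrightarrow> summable (\<lambda>m. 2 ^ m * U (2 ^ m * t))"
    "\<And>t. t0 \<le> t \<Longrightarrow> (\<Sum>m. 2 ^ m * U (2 ^ m * t)) \<le> C * U t"
proof -
  have pos: "0 < U t" for t by (rule regularly_varying_pos[OF rv U(1)])
  have "(2::real) powr \<rho> < 2 powr (-1)" using \<open>\<rho> < -1\<close> by (intro powr_less_mono) auto
  then have "(2::real) powr \<rho> < 1/2" by (simp add: powr_minus)
  then obtain q :: real where q: "2 powr \<rho> < q" "q < 1/2" using dense by blast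
  have "((\<lambda>t. U (t * 2) / U t) \<longlongrightarrow> 2 powr \<rho>) at_top"
    using rv by (simp add: regularly_varying_def)
  then have "\<forall>\<^sub>F t in at_top. U (t * 2) / U t < q" by (rule order_tendstoD) (rule q)
  then obtain t1 where t1: "\<And>t. t \<ge> t1 \<Longrightarrow> U (t * 2) / U t < q"
    by (auto simp: eventually_at_top_linorder)
  define t0 where "t0 = max 1 t1"
  have q0: "0 < q" using q(1) powr_gt_zero[of 2 \<rho>] by linarith
  have bound: "2 ^ m * U (2 ^ m * t) \<le> (2 * q) ^ m * U t" if "t0 \<le> t" for t m
  proof -
    have "U (2 ^ m * t) \<le> q ^ m * U t"
    proof (induction m)
      case (Suc m)
      have "1 * t \<le> 2 ^ m * t" using that by (intro mult_right_mono) (auto simp: t0_def)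
      moreover have "t1 \<le> t" using that by (simp add: t0_def)
      ultimately have "t1 \<le> 2 ^ m * t" by linarith
      then have "U (2 ^ m * t * 2) / U (2 ^ m * t) < q" by (rule t1)
      then have "U (2 ^ Suc m * t) \<le> q * U (2 ^ m * t)"
        using pos[of "2 ^ m * t"] by (simp add: field_simps)
      also have "\<dots> \<le> q * (q ^ m * U t)" using Suc q0 by (intro mult_left_mono) auto
      finally show ?case by simp
    qed simp
    then show ?thesis by (simp add: power_mult_distrib)
  qed
  have summ: "summable (\<lambda>m. (2 * q) ^ m * U t)" for t
    using q q0 by (intro summable_mult2 summable_geometric) auto
  have summ': "summable (\<lambda>m. 2 ^ m * U (2 ^ m * t))" if "t0 \<le> t" for t
    by (rule summable_comparison_test'[OF summ[of t], of 0])
       (use bound[OF that] pos in \<open>auto simp: abs_mult less_imp_le\<close>)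
  show ?thesis
  proof (rule that)
    show "0 < 1 / (1 - 2 * q)" "0 < t0" using q by (auto simp: t0_def)
    fix t assume t: "t0 \<le> t"
    show "summable (\<lambda>m. 2 ^ m * U (2 ^ m * t))" by (rule summ'[OF t])
    have "(\<Sum>m. 2 ^ m * U (2 ^ m * t)) \<le> (\<Sum>m. (2 * q) ^ m * U t)"
      by (intro suminf_le bound t summ summ')
    also have "\<dots> = 1 / (1 - 2 * q) * U t"
      using q q0 by (subst suminf_mult2[symmetric]) (auto simp: suminf_geometric intro!: summable_geometric)
    finally show "(\<Sum>m. 2 ^ m * U (2 ^ m * t)) \<le> 1 / (1 - 2 * q) * U t" .
  qed
qed

lemma excess_le_dyadic_sum:
  fixes x t :: real
  assumes "x \<le> 2 ^ M * t" "0 < t"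
  shows "max 0 (x - t) \<le> (\<Sum>m<M. 2 ^ m * t * indicator {2 ^ m * t<..} x)"
  using assms(1)
proof (induction M)
  case (Suc M)
  show ?case
  proof (cases "x \<le> 2 ^ M * t")
    case True
    have "0 \<le> 2 ^ M * t * indicator {2 ^ M * t<..} x" using assms(2) by simp
    with Suc.IH[OF True] show ?thesis by simp
  next
    case False
    have "indicator {2 ^ m * t<..} x = (1::real)" if "m < Suc M" for m
    proof -
      have "2 ^ m * t \<le> 2 ^ M * t" using that assms(2) by (intro mult_right_mono power_increasing) auto
      then show ?thesis using False by simp
    qed
    then have "(\<Sum>m<Suc M. 2 ^ m * t * indicator {2 ^ m * t<..} x) = (\<Sum>m<Suc M. 2 ^ m * t)"
      by (intro sum.cong) auto
    also have "\<dots> = (\<Sum>m<Suc M. 2 ^ m) * t" by (rule sum_distrib_right[symmetric])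
    also have "(\<Sum>m<Suc M. (2::real) ^ m) = 2 ^ Suc M - 1" by (subst geometric_sum) auto
    also have "(2 ^ Suc M - 1) * t = 2 ^ Suc M * t - t" by (simp add: left_diff_distrib)
    finally have *: "(\<Sum>m<Suc M. 2 ^ m * t * indicator {2 ^ m * t<..} x) = 2 ^ Suc M * t - t" .
    have "1 * t \<le> 2 ^ Suc M * t"
      using one_le_power[of "2::real" "Suc M"] assms(2) by (intro mult_right_mono) auto
    then show ?thesis unfolding * using Suc.prems by auto
  qed
qed simp

text \<open>
  Lower and upper Riemann sums, on the grid \<open>u * r ^ m\<close>, for the integral of \<open>s powr - \<alpha>\<close> from \<open>u\<close> to
  infinity, which is \<open>u powr (1 - \<alpha>) / (\<alpha> - 1)\<close>. On a geometric grid they are geometric sums, and the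
  limit for \<open>r\<close> tending to 1 is the derivative of \<open>r powr (1 - \<alpha>)\<close> at 1.
\<close>

lemma geometric_riemann_sums:
  fixes \<alpha> u \<epsilon> :: real
  assumes "1 < \<alpha>" "0 < u" "0 < \<epsilon>"
  obtains r where "1 < r"
    "\<forall>\<^sub>F J in sequentially. u powr (1 - \<alpha>) / (\<alpha> - 1) - \<epsilon>
        < (\<Sum>m<J. (u * r ^ Suc m - u * r ^ m) * (u * r ^ Suc m) powr - \<alpha>)"
    "\<And>J. (\<Sum>m<J. (u * r ^ Suc m - u * r ^ m) * (u * r ^ m) powr - \<alpha>)
        < u powr (1 - \<alpha>) / (\<alpha> - 1) + \<epsilon>"
proof -
  \<comment> \<open>the full upper sum; the lower one is smaller by the factor \<open>r powr - \<alpha>\<close>\<close>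
  define S where "S = (\<lambda>r. u powr (1 - \<alpha>) * ((r - 1) / (1 - r powr (1 - \<alpha>))))"
  have "((\<lambda>r::real. r powr (1 - \<alpha>)) has_field_derivative (1 - \<alpha>)) (at 1)"
    by (auto intro!: derivative_eq_intros)
  then have "((\<lambda>r::real. (r powr (1 - \<alpha>) - 1) / (r - 1)) \<longlongrightarrow> 1 - \<alpha>) (at 1)"
    by (simp add: has_field_derivative_iff)
  then have "((\<lambda>r::real. inverse (- ((r powr (1 - \<alpha>) - 1) / (r - 1)))) \<longlongrightarrow> inverse (- (1 - \<alpha>))) (at 1)"
    using assms by (intro tendsto_inverse tendsto_minus) auto
  moreover have "inverse (- ((r powr (1 - \<alpha>) - 1) / (r - 1))) = (r - 1) / (1 - r powr (1 - \<alpha>))" for r :: real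
    by (simp add: minus_divide_left)
  ultimately have lim: "((\<lambda>r::real. (r - 1) / (1 - r powr (1 - \<alpha>))) \<longlongrightarrow> 1 / (\<alpha> - 1)) (at 1)"
    by (simp add: inverse_eq_divide)
  have "(S \<longlongrightarrow> u powr (1 - \<alpha>) * (1 / (\<alpha> - 1))) (at_right 1)"
    unfolding S_def by (intro tendsto_mult_left tendsto_within_subset[OF lim]) auto
  then have S: "(S \<longlongrightarrow> u powr (1 - \<alpha>) / (\<alpha> - 1)) (at_right 1)" by simp
  have "((\<lambda>r::real. r powr - \<alpha> * S r) \<longlongrightarrow> 1 powr - \<alpha> * (u powr (1 - \<alpha>) / (\<alpha> - 1))) (at_right 1)"
    by (intro tendsto_intros S) auto
  then have "\<forall>\<^sub>F r in at_right 1. u powr (1 - \<alpha>) / (\<alpha> - 1) - \<epsilon> < r powr - \<alpha> * S r"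
    by (rule order_tendstoD) (use assms in auto)
  moreover have "\<forall>\<^sub>F r in at_right 1. S r < u powr (1 - \<alpha>) / (\<alpha> - 1) + \<epsilon>"
    by (rule order_tendstoD[OF S]) (use assms in auto)
  ultimately have "\<forall>\<^sub>F r in at_right (1::real). 1 < r \<and> u powr (1 - \<alpha>) / (\<alpha> - 1) - \<epsilon> < r powr - \<alpha> * S r
      \<and> S r < u powr (1 - \<alpha>) / (\<alpha> - 1) + \<epsilon>"
    using eventually_at_right_less[of "1::real"] by eventually_elim auto
  then obtain r :: real where r: "1 < r" "u powr (1 - \<alpha>) / (\<alpha> - 1) - \<epsilon> < r powr - \<alpha> * S r"
     "S r < u powr (1 - \<alpha>) / (\<alpha> - 1) + \<epsilon>" by (auto dest!: eventually_happens'[rotated])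
  have q: "0 < r powr (1 - \<alpha>)" "r powr (1 - \<alpha>) < 1" using r(1) assms(1) by (auto simp: powr_less_one)
  have geo: "(u * r ^ Suc m - u * r ^ m) * (u * r ^ m) powr - \<alpha> = (u powr (1 - \<alpha>) * (r - 1)) * (r powr (1 - \<alpha>)) ^ m" for m
  proof -
    have "(u * r ^ m) powr - \<alpha> * (u * r ^ m) = (u * r ^ m) powr (1 - \<alpha>)"
      using assms(2) r(1) powr_add[of "u * r ^ m" "- \<alpha>" 1] by (simp add: algebra_simps)
    also have "\<dots> = u powr (1 - \<alpha>) * (r ^ m) powr (1 - \<alpha>)"
      using assms(2) r(1) by (simp add: powr_mult)
    also have "(r ^ m) powr (1 - \<alpha>) = (r powr (1 - \<alpha>)) ^ m"
      using r(1) by (induction m) (auto simp: powr_mult)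
    finally have "(u * r ^ m) powr - \<alpha> * (u * r ^ m) * (r - 1) = u powr (1 - \<alpha>) * (r powr (1 - \<alpha>)) ^ m * (r - 1)"
      by simp
    then show ?thesis by (simp add: algebra_simps)
  qed
  have geo': "(u * r ^ Suc m - u * r ^ m) * (u * r ^ Suc m) powr - \<alpha>
      = r powr - \<alpha> * ((u powr (1 - \<alpha>) * (r - 1)) * (r powr (1 - \<alpha>)) ^ m)" for m
  proof -
    have "(u * r ^ Suc m) powr - \<alpha> = r powr - \<alpha> * (u * r ^ m) powr - \<alpha>"
      using assms(2) r(1) powr_mult[of r "u * r ^ m" "- \<alpha>"] by (simp add: mult_ac)
    then show ?thesis using geo[of m] by (metis (no_types, lifting) mult.left_commute)
  qed
  have "(\<lambda>m. (r powr (1 - \<alpha>)) ^ m) sums (1 / (1 - r powr (1 - \<alpha>)))"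
    using q by (intro geometric_sums) auto
  then have sums: "(\<lambda>m. (u powr (1 - \<alpha>) * (r - 1)) * (r powr (1 - \<alpha>)) ^ m) sums S r"
    using sums_mult[of _ _ "u powr (1 - \<alpha>) * (r - 1)"] by (fastforce simp: S_def)
  show ?thesis
  proof (rule that[OF r(1)])
    have "(\<lambda>J. \<Sum>m<J. (u * r ^ Suc m - u * r ^ m) * (u * r ^ Suc m) powr - \<alpha>) \<longlonglongrightarrow> r powr - \<alpha> * S r"
      unfolding geo' using sums_mult[OF sums, of "r powr - \<alpha>"] by (simp add: sums_def)
    then show "\<forall>\<^sub>F J in sequentially. u powr (1 - \<alpha>) / (\<alpha> - 1) - \<epsilon>
        < (\<Sum>m<J. (u * r ^ Suc m - u * r ^ m) * (u * r ^ Suc m) powr - \<alpha>)"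
      by (rule order_tendstoD) (rule r)
    fix J
    have "(\<Sum>m<J. (u powr (1 - \<alpha>) * (r - 1)) * (r powr (1 - \<alpha>)) ^ m) \<le> S r"
      unfolding sums_unique[OF sums] using r(1)
      by (intro sum_le_suminf sums_summable[OF sums]) auto
    then show "(\<Sum>m<J. (u * r ^ Suc m - u * r ^ m) * (u * r ^ m) powr - \<alpha>)
        < u powr (1 - \<alpha>) / (\<alpha> - 1) + \<epsilon>"
      unfolding geo using r(3) by linarith
  qed
qed

section \<open>Events of probability tending to one\<close>

text \<open>
  The events \<open>A\<close> are demanded explicitly so that no measurability of \<open>P\<close> is needed. Since \<open>A\<close> may
  depend on \<open>\<delta>\<close>, properties that fail with small but not vanishing probability can still be combined
  and passed to the limit.
\<close>

definition whp :: "'a measure \<Rightarrow> (nat \<times> 'a) filter" where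
  "whp M = Abs_filter (\<lambda>P. \<forall>\<delta>>0. \<forall>\<^sub>F n in sequentially.
     \<exists>A\<in>sets M. measure M (space M - A) < \<delta> \<and> (\<forall>\<omega>\<in>A. P (n, \<omega>)))"

lemma (in finite_measure) eventually_whp:
  "eventually P (whp M) \<longleftrightarrow> (\<forall>\<delta>>0. \<forall>\<^sub>F n in sequentially.
     \<exists>A\<in>sets M. measure M (space M - A) < \<delta> \<and> (\<forall>\<omega>\<in>A. P (n, \<omega>)))"
  unfolding whp_def
proof (rule eventually_Abs_filter, unfold_locales)
  show "\<forall>\<delta>>0. \<forall>\<^sub>F n in sequentially.
     \<exists>A\<in>sets M. measure M (space M - A) < \<delta> \<and> (\<forall>\<omega>\<in>A. True)"
    by (auto intro!: always_eventually bexI[of _ "space M"])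
next
  fix P Q :: "nat \<times> 'a \<Rightarrow> bool"
  assume P: "\<forall>\<delta>>0. \<forall>\<^sub>F n in sequentially.
     \<exists>A\<in>sets M. measure M (space M - A) < \<delta> \<and> (\<forall>\<omega>\<in>A. P (n, \<omega>))"
  assume Q: "\<forall>\<delta>>0. \<forall>\<^sub>F n in sequentially.
     \<exists>A\<in>sets M. measure M (space M - A) < \<delta> \<and> (\<forall>\<omega>\<in>A. Q (n, \<omega>))"
  show "\<forall>\<delta>>0. \<forall>\<^sub>F n in sequentially.
     \<exists>A\<in>sets M. measure M (space M - A) < \<delta> \<and> (\<forall>\<omega>\<in>A. P (n, \<omega>) \<and> Q (n, \<omega>))"
  proof (intro allI impI)
    fix \<delta> :: real assume "0 < \<delta>"
    then have "0 < \<delta> / 2" by simp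
    with P Q have "\<forall>\<^sub>F n in sequentially.
       \<exists>A\<in>sets M. measure M (space M - A) < \<delta> / 2 \<and> (\<forall>\<omega>\<in>A. P (n, \<omega>))"
     "\<forall>\<^sub>F n in sequentially.
       \<exists>A\<in>sets M. measure M (space M - A) < \<delta> / 2 \<and> (\<forall>\<omega>\<in>A. Q (n, \<omega>))" by blast+
    then show "\<forall>\<^sub>F n in sequentially.
       \<exists>A\<in>sets M. measure M (space M - A) < \<delta> \<and> (\<forall>\<omega>\<in>A. P (n, \<omega>) \<and> Q (n, \<omega>))"
    proof eventually_elim
      case (elim n)
      then obtain A B where AB: "A \<in> sets M" "measure M (space M - A) < \<delta> / 2" "\<forall>\<omega>\<in>A. P (n, \<omega>)"
        "B \<in> sets M" "measure M (space M - B) < \<delta> / 2" "\<forall>\<omega>\<in>B. Q (n, \<omega>)" by blast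
      have "measure M (space M - A \<inter> B) \<le> measure M (space M - A) + measure M (space M - B)"
        unfolding Diff_Int using AB by (intro measure_Un_le) auto
      with AB show ?case by (intro bexI[of _ "A \<inter> B"]) auto
    qed
  qed
next
  fix P Q :: "nat \<times> 'a \<Rightarrow> bool"
  assume "\<forall>x. P x \<longrightarrow> Q x" and P: "\<forall>\<delta>>0. \<forall>\<^sub>F n in sequentially.
     \<exists>A\<in>sets M. measure M (space M - A) < \<delta> \<and> (\<forall>\<omega>\<in>A. P (n, \<omega>))"
  then show "\<forall>\<delta>>0. \<forall>\<^sub>F n in sequentially.
     \<exists>A\<in>sets M. measure M (space M - A) < \<delta> \<and> (\<forall>\<omega>\<in>A. Q (n, \<omega>))"
    by (fastforce elim: eventually_mono)
qed

lemma (in finite_measure) filterlim_fst_whp: "filterlim fst sequentially (whp M)"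
  unfolding filterlim_iff
proof (intro allI impI)
  fix P :: "nat \<Rightarrow> bool" assume "eventually P sequentially"
  then show "\<forall>\<^sub>F x in whp M. P (fst x)"
    unfolding eventually_whp
    by (auto elim!: eventually_mono intro!: bexI[of _ "space M"])
qed

text \<open>
  This allows an approximation step whose error has probability below \<open>\<delta>\<close>, where the approximation
  itself depends on \<open>\<delta>\<close>, as in a truncation argument.
\<close>

lemma (in finite_measure) whp_mono_approx:
  assumes "\<And>\<delta>. 0 < \<delta> \<Longrightarrow> \<exists>Q. eventually Q (whp M) \<and> (\<forall>\<^sub>F n in sequentially.
      \<exists>A\<in>sets M. measure M (space M - A) < \<delta> \<and> (\<forall>\<omega>\<in>A. Q (n, \<omega>) \<longrightarrow> P (n, \<omega>)))"
  shows "eventually P (whp M)"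
  unfolding eventually_whp
proof (intro allI impI)
  fix \<delta> :: real assume "0 < \<delta>"
  then obtain Q where Q: "eventually Q (whp M)" "\<forall>\<^sub>F n in sequentially.
      \<exists>A\<in>sets M. measure M (space M - A) < \<delta> / 2 \<and> (\<forall>\<omega>\<in>A. Q (n, \<omega>) \<longrightarrow> P (n, \<omega>))"
    using assms[of "\<delta> / 2"] by auto
  have "\<forall>\<^sub>F n in sequentially.
      \<exists>A\<in>sets M. measure M (space M - A) < \<delta> / 2 \<and> (\<forall>\<omega>\<in>A. Q (n, \<omega>))"
    using Q(1) half_gt_zero[OF \<open>0 < \<delta>\<close>] unfolding eventually_whp by blast
  with Q(2) show "\<forall>\<^sub>F n in sequentially.
      \<exists>A\<in>sets M. measure M (space M - A) < \<delta> \<and> (\<forall>\<omega>\<in>A. P (n, \<omega>))"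
  proof eventually_elim
    case (elim n)
    then obtain A B where AB: "A \<in> sets M" "measure M (space M - A) < \<delta> / 2" "\<forall>\<omega>\<in>A. Q (n, \<omega>) \<longrightarrow> P (n, \<omega>)"
      "B \<in> sets M" "measure M (space M - B) < \<delta> / 2" "\<forall>\<omega>\<in>B. Q (n, \<omega>)" by blast
    have "measure M (space M - A \<inter> B) \<le> measure M (space M - A) + measure M (space M - B)"
      unfolding Diff_Int using AB by (intro measure_Un_le) auto
    with AB show ?case by (intro bexI[of _ "A \<inter> B"]) auto
  qed
qed

lemma (in finite_measure) measure_bad_tendsto_0:
  assumes "eventually P (whp M)"
  shows "(\<lambda>n. measure M {\<omega> \<in> space M. \<not> P (n, \<omega>)}) \<longlonglongrightarrow> 0"
proof (rule tendstoI)
  fix \<delta> :: real assume "0 < \<delta>"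
  then have "\<forall>\<^sub>F n in sequentially.
      \<exists>A\<in>sets M. measure M (space M - A) < \<delta> \<and> (\<forall>\<omega>\<in>A. P (n, \<omega>))"
    using assms unfolding eventually_whp by simp
  then show "\<forall>\<^sub>F n in sequentially. dist (measure M {\<omega> \<in> space M. \<not> P (n, \<omega>)}) 0 < \<delta>"
  proof eventually_elim
    case (elim n)
    then obtain A where A: "A \<in> sets M" "measure M (space M - A) < \<delta>" "\<forall>\<omega>\<in>A. P (n, \<omega>)" by blast
    have "measure M {\<omega> \<in> space M. \<not> P (n, \<omega>)} \<le> measure M (space M - A)"
      using A by (intro finite_measure_mono) auto
    with A(2) show ?case by (simp add: dist_real_def)
  qed
qed

lemma (in prob_space) second_moment_indep_sum:
  fixes Z :: "'i \<Rightarrow> 'a \<Rightarrow> real"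
  assumes "finite I" "indep_vars (\<lambda>_. borel) Z I"
    and "\<And>i. i \<in> I \<Longrightarrow> integrable M (\<lambda>\<omega>. (Z i \<omega>)\<^sup>2)" "\<And>i. i \<in> I \<Longrightarrow> expectation (Z i) = 0"
  shows "integrable M (\<lambda>\<omega>. (\<Sum>i\<in>I. Z i \<omega>)\<^sup>2)"
    and "expectation (\<lambda>\<omega>. (\<Sum>i\<in>I. Z i \<omega>)\<^sup>2) = (\<Sum>i\<in>I. expectation (\<lambda>\<omega>. (Z i \<omega>)\<^sup>2))"
proof -
  have rv: "Z i \<in> borel_measurable M" if "i \<in> I" for i
    using assms(2) that by (auto simp: indep_vars_def)
  have int: "integrable M (Z i)" if "i \<in> I" for i
    using rv[OF that] assms(3)[OF that] by (rule square_integrable_imp_integrable)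
  have "integrable M (\<lambda>\<omega>. (\<Sum>i\<in>J. Z i \<omega>)\<^sup>2) \<and>
    expectation (\<lambda>\<omega>. (\<Sum>i\<in>J. Z i \<omega>)\<^sup>2) = (\<Sum>i\<in>J. expectation (\<lambda>\<omega>. (Z i \<omega>)\<^sup>2))"
    if "finite J" "J \<subseteq> I" for J
    using that
  proof (induction J)
    case (insert i J)
    define S where "S = (\<lambda>\<omega>. \<Sum>i\<in>J. Z i \<omega>)"
    have indep: "indep_var borel (Z i) borel S"
      unfolding S_def using insert
      by (intro indep_vars_sum indep_vars_subset[OF assms(2)]) auto
    have intZ: "integrable M (Z i)" using insert int by auto
    have intS: "integrable M S" unfolding S_def using insert int by auto
    have prod: "integrable M (\<lambda>\<omega>. Z i \<omega> * S \<omega>)" "expectation (\<lambda>\<omega>. Z i \<omega> * S \<omega>) = 0"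
      using indep_var_integrable[OF indep intZ intS] indep_var_lebesgue_integral[OF indep intZ intS]
        assms(4)[of i] insert.prems by simp_all
    have eq: "(\<lambda>\<omega>. (\<Sum>i\<in>insert i J. Z i \<omega>)\<^sup>2) = (\<lambda>\<omega>. (Z i \<omega>)\<^sup>2 + (2 * (Z i \<omega> * S \<omega>) + (S \<omega>)\<^sup>2))"
      using insert.hyps by (auto simp: S_def power2_eq_square algebra_simps)
    have IH: "integrable M (\<lambda>\<omega>. (S \<omega>)\<^sup>2)"
      "expectation (\<lambda>\<omega>. (S \<omega>)\<^sup>2) = (\<Sum>i\<in>J. expectation (\<lambda>\<omega>. (Z i \<omega>)\<^sup>2))"
      using insert unfolding S_def by auto
    have sq: "integrable M (\<lambda>\<omega>. (Z i \<omega>)\<^sup>2)" using insert.prems assms(3) by auto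
    show ?case unfolding eq using insert.hyps IH sq prod by simp
  qed simp
  from this[OF assms(1)] show "integrable M (\<lambda>\<omega>. (\<Sum>i\<in>I. Z i \<omega>)\<^sup>2)"
    "expectation (\<lambda>\<omega>. (\<Sum>i\<in>I. Z i \<omega>)\<^sup>2) = (\<Sum>i\<in>I. expectation (\<lambda>\<omega>. (Z i \<omega>)\<^sup>2))" by auto
qed

section \<open>Number of exceedances and total excess\<close>

definition exceedances :: "(nat \<Rightarrow> real) \<Rightarrow> nat \<Rightarrow> real \<Rightarrow> nat" where
  "exceedances x n v = card {j \<in> {1..n}. v < x j}"

definition total_excess :: "(nat \<Rightarrow> real) \<Rightarrow> nat \<Rightarrow> real \<Rightarrow> real" where
  "total_excess x n v = (\<Sum>j=1..n. max 0 (x j - v))"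

lemma sum_indicator_exceedances:
  "(\<Sum>j=1..n. indicator {v<..} (x j)) = real (exceedances x n v)"
proof -
  have "(\<Sum>j=1..n. indicator {v<..} (x j)) = (\<Sum>j\<in>{1..n}. if v < x j then 1 else (0::real))"
    by (intro sum.cong) (auto simp: indicator_def)
  also have "\<dots> = real (exceedances x n v)"
    by (simp add: exceedances_def sum.If_cases Int_def)
  finally show ?thesis .
qed

lemma mean_excess_eq:
  "mean_excess x n v = total_excess x n v / real (exceedances x n v)"
proof -
  have "(\<Sum>j=1..n. (x j - v) * indicator {v<..} (x j)) = total_excess x n v"
    unfolding total_excess_def by (intro sum.cong) (auto simp: indicator_def)
  then show ?thesis
    unfolding mean_excess_def Let_def sum_indicator_exceedances by simp
qed

lemma exceedances_antimono: "v \<le> w \<Longrightarrow> exceedances x n w \<le> exceedances x n v"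
  unfolding exceedances_def by (rule card_mono) auto

lemma total_excess_nonneg: "0 \<le> total_excess x n v"
  unfolding total_excess_def by (intro sum_nonneg) auto

text \<open>
  The total excess is the integral over \<open>v\<close> of the number of exceedances, which is decreasing in \<open>v\<close>.
  These are the bounds for its increments.
\<close>

lemma total_excess_diff_bounds:
  assumes "v \<le> w"
  shows "(w - v) * real (exceedances x n w) \<le> total_excess x n v - total_excess x n w"
    and "total_excess x n v - total_excess x n w \<le> (w - v) * real (exceedances x n v)"
proof -
  have diff: "total_excess x n v - total_excess x n w = (\<Sum>j=1..n. max 0 (x j - v) - max 0 (x j - w))"
    by (simp add: total_excess_def sum_subtractf)
  show "(w - v) * real (exceedances x n w) \<le> total_excess x n v - total_excess x n w"
    unfolding diff sum_indicator_exceedances[symmetric] sum_distrib_left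
    by (rule sum_mono) (use assms in \<open>auto simp: indicator_def\<close>)
  show "total_excess x n v - total_excess x n w \<le> (w - v) * real (exceedances x n v)"
    unfolding diff sum_indicator_exceedances[symmetric] sum_distrib_left
    by (rule sum_mono) (use assms in \<open>auto simp: indicator_def\<close>)
qed

lemma total_excess_antimono: "v \<le> w \<Longrightarrow> total_excess x n w \<le> total_excess x n v"
  using total_excess_diff_bounds(1)[of v w x n]
  by (smt (verit) mult_nonneg_nonneg of_nat_0_le_iff)

section \<open>Deviation bounds for independent samples\<close>

locale iid_sample = prob_space M for M :: "'a measure" +
  fixes X :: "nat \<Rightarrow> 'a \<Rightarrow> real" and U :: "real \<Rightarrow> real"
  assumes X_meas: "\<And>n. n \<ge> 1 \<Longrightarrow> X n \<in> borel_measurable M"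
    and X_indep: "indep_vars (\<lambda>_. borel) X {1..}"
    and X_tail: "\<And>n t. n \<ge> 1 \<Longrightarrow> prob {\<omega> \<in> space M. t < X n \<omega>} = U t"
begin

lemma measurable_exceedances:
  assumes [measurable]: "V \<in> borel_measurable M"
  shows "(\<lambda>\<omega>. real (exceedances (\<lambda>j. X j \<omega>) n (V \<omega>))) \<in> borel_measurable M"
proof -
  have "(\<lambda>\<omega>. if V \<omega> < X j \<omega> then 1 else (0::real)) \<in> borel_measurable M" if "j \<in> {1..n}" for j
  proof -
    have [measurable]: "X j \<in> borel_measurable M" using X_meas that by auto
    show ?thesis by measurable
  qed
  then have "(\<lambda>\<omega>. \<Sum>j=1..n. if V \<omega> < X j \<omega> then 1 else (0::real)) \<in> borel_measurable M"
    by (rule borel_measurable_sum)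
  moreover have "(\<Sum>j=1..n. if V \<omega> < X j \<omega> then 1 else (0::real)) = real (exceedances (\<lambda>j. X j \<omega>) n (V \<omega>))" for \<omega>
    unfolding sum_indicator_exceedances[symmetric] by (intro sum.cong) (auto simp: indicator_def)
  ultimately show ?thesis by simp
qed

lemma measurable_total_excess:
  assumes [measurable]: "V \<in> borel_measurable M"
  shows "(\<lambda>\<omega>. total_excess (\<lambda>j. X j \<omega>) n (V \<omega>)) \<in> borel_measurable M"
  unfolding total_excess_def
proof (rule borel_measurable_sum)
  fix j assume "j \<in> {1..n}"
  then have [measurable]: "X j \<in> borel_measurable M" using X_meas by auto
  show "(\<lambda>\<omega>. max 0 (X j \<omega> - V \<omega>)) \<in> borel_measurable M" by measurable
qed

lemmas measurable_exceedances_const [measurable] = measurable_exceedances[OF borel_measurable_const]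
lemmas measurable_total_excess_const [measurable] = measurable_total_excess[OF borel_measurable_const]

text \<open>
  The number of exceedances is binomial, with variance at most its mean \<open>n * U v\<close>.
\<close>

lemma prob_exceedances_deviation:
  assumes "0 < a"
  shows "prob {\<omega> \<in> space M. a \<le> \<bar>real (exceedances (\<lambda>j. X j \<omega>) n v) - real n * U v\<bar>} \<le> real n * U v / a\<^sup>2"
proof -
  define Z where "Z = (\<lambda>j \<omega>. indicator {v<..} (X j \<omega>) - U v)"
  have U: "0 \<le> U v" using X_tail[of 1 v] by (metis measure_nonneg order_refl)
  have ind: "integrable M (\<lambda>\<omega>. indicator {v<..} (X j \<omega>) :: real)"
    "expectation (\<lambda>\<omega>. indicator {v<..} (X j \<omega>)) = U v" if "j \<ge> 1" for j
  proof -
    have eq: "(\<lambda>\<omega>. indicator {v<..} (X j \<omega>)) = indicator {\<omega>. v < X j \<omega>}"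
      by (auto simp: indicator_def)
    have "{\<omega> \<in> space M. v < X j \<omega>} \<in> sets M" using X_meas[OF that] by measurable
    then show "integrable M (\<lambda>\<omega>. indicator {v<..} (X j \<omega>) :: real)"
      "expectation (\<lambda>\<omega>. indicator {v<..} (X j \<omega>)) = U v"
      using X_tail[OF that, of v] unfolding eq
      by (auto simp: integrable_indicator_iff Int_def conj_commute fmeasurable_def emeasure_eq_measure)
  qed
  have Z2: "(\<lambda>\<omega>. (Z j \<omega>)\<^sup>2) = (\<lambda>\<omega>. (1 - 2 * U v) * indicator {v<..} (X j \<omega>) + (U v)\<^sup>2)" for j
    by (auto simp: Z_def indicator_def power2_eq_square algebra_simps)
  have Zint: "integrable M (\<lambda>\<omega>. (Z j \<omega>)\<^sup>2)" if "j \<ge> 1" for j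
    unfolding Z2 using ind(1)[OF that] by auto
  have Zvar: "expectation (\<lambda>\<omega>. (Z j \<omega>)\<^sup>2) \<le> U v" if "j \<ge> 1" for j
  proof -
    have "expectation (\<lambda>\<omega>. (Z j \<omega>)\<^sup>2) = (1 - 2 * U v) * U v + (U v)\<^sup>2"
      unfolding Z2 using ind[OF that] by (simp add: prob_space)
    also have "\<dots> = U v - (U v)\<^sup>2" by (simp add: power2_eq_square algebra_simps)
    finally show ?thesis by simp
  qed
  have indepZ: "indep_vars (\<lambda>_. borel) Z {1..n}"
    unfolding Z_def
    by (rule indep_vars_compose2[OF indep_vars_subset[OF X_indep], where Y="\<lambda>j x. indicator {v<..} x - U v"]) auto
  have EZ: "expectation (Z j) = 0" if "j \<ge> 1" for j
    unfolding Z_def using ind[OF that] by (simp add: prob_space)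
  have sumZ: "(\<Sum>j=1..n. Z j \<omega>) = real (exceedances (\<lambda>j. X j \<omega>) n v) - real n * U v" for \<omega>
    by (simp add: Z_def sum_subtractf sum_indicator_exceedances del: One_nat_def)
  have m: "integrable M (\<lambda>\<omega>. (\<Sum>j=1..n. Z j \<omega>)\<^sup>2)"
    "expectation (\<lambda>\<omega>. (\<Sum>j=1..n. Z j \<omega>)\<^sup>2) = (\<Sum>j=1..n. expectation (\<lambda>\<omega>. (Z j \<omega>)\<^sup>2))"
    using second_moment_indep_sum[OF _ indepZ] Zint EZ by auto
  have "{\<omega> \<in> space M. a \<le> \<bar>\<Sum>j=1..n. Z j \<omega>\<bar>} = {\<omega> \<in> space M. a\<^sup>2 \<le> (\<Sum>j=1..n. Z j \<omega>)\<^sup>2}"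
    using assms abs_le_square_iff[of a] by auto
  moreover have "prob {\<omega> \<in> space M. a\<^sup>2 \<le> (\<Sum>j=1..n. Z j \<omega>)\<^sup>2} \<le> expectation (\<lambda>\<omega>. (\<Sum>j=1..n. Z j \<omega>)\<^sup>2) / a\<^sup>2"
    by (rule integral_Markov_inequality_measure[where A="space M"]) (use assms m in auto)
  moreover have "expectation (\<lambda>\<omega>. (\<Sum>j=1..n. Z j \<omega>)\<^sup>2) \<le> real n * U v"
    unfolding m(2) using sum_bounded_above[of "{1..n}" "\<lambda>j. expectation (\<lambda>\<omega>. (Z j \<omega>)\<^sup>2)" "U v"] Zvar by auto
  ultimately show ?thesis
    unfolding sumZ by (smt (verit) divide_right_mono zero_le_power2)
qed

lemma exceedances_tendsto:
  fixes k :: "nat \<Rightarrow> nat" and v :: "nat \<Rightarrow> real"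
  assumes lim: "(\<lambda>n. real n * U (v n) / real (k n)) \<longlonglongrightarrow> l" and k: "filterlim k at_top sequentially"
  shows "((\<lambda>(n, \<omega>). real (exceedances (\<lambda>j. X j \<omega>) n (v n)) / real (k n)) \<longlongrightarrow> l) (whp M)"
proof (rule tendstoI)
  fix \<epsilon> :: real assume \<epsilon>: "0 < \<epsilon>"
  have kr: "filterlim (\<lambda>n. real (k n)) at_top sequentially"
    by (rule filterlim_compose[OF filterlim_real_sequentially k])
  show "\<forall>\<^sub>F x in whp M. dist (case x of (n, \<omega>) \<Rightarrow> real (exceedances (\<lambda>j. X j \<omega>) n (v n)) / real (k n)) l < \<epsilon>"
    unfolding eventually_whp
  proof (intro allI impI)
    fix \<delta> :: real assume \<delta>: "0 < \<delta>"
    have "(\<lambda>n. real n * U (v n) / real (k n) * inverse (real (k n)) * (4 / \<epsilon>\<^sup>2)) \<longlonglongrightarrow> l * 0 * (4 / \<epsilon>\<^sup>2)"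
      by (intro tendsto_intros lim tendsto_inverse_0_at_top kr)
    then have "\<forall>\<^sub>F n in sequentially. real n * U (v n) / real (k n) * inverse (real (k n)) * (4 / \<epsilon>\<^sup>2) < \<delta>"
      by (rule order_tendstoD) (use \<delta> in simp)
    moreover have "\<forall>\<^sub>F n in sequentially. dist (real n * U (v n) / real (k n)) l < \<epsilon> / 2"
      using \<epsilon> by (intro tendstoD[OF lim]) simp
    moreover have "\<forall>\<^sub>F n in sequentially. 0 < real (k n)"
      using kr unfolding filterlim_at_top_dense by blast
    ultimately show "\<forall>\<^sub>F n in sequentially. \<exists>A\<in>sets M. prob (space M - A) < \<delta> \<and>
      (\<forall>\<omega>\<in>A. dist (case (n, \<omega>) of (n, \<omega>) \<Rightarrow> real (exceedances (\<lambda>j. X j \<omega>) n (v n)) / real (k n)) l < \<epsilon>)"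
    proof eventually_elim
      case (elim n)
      define a where "a = \<epsilon> / 2 * real (k n)"
      have a: "0 < a" using \<epsilon> elim(3) by (simp add: a_def)
      let ?D = "\<lambda>\<omega>. \<bar>real (exceedances (\<lambda>j. X j \<omega>) n (v n)) - real n * U (v n)\<bar>"
      have "space M - {\<omega> \<in> space M. ?D \<omega> < a} = {\<omega> \<in> space M. a \<le> ?D \<omega>}" by auto
      then have "prob (space M - {\<omega> \<in> space M. ?D \<omega> < a}) \<le> real n * U (v n) / a\<^sup>2"
        using prob_exceedances_deviation[OF a] by simp
      also have "\<dots> = real n * U (v n) / real (k n) * inverse (real (k n)) * (4 / \<epsilon>\<^sup>2)"
        using elim(3) \<epsilon> by (simp add: a_def field_simps power2_eq_square)
      finally have "prob (space M - {\<omega> \<in> space M. ?D \<omega> < a}) < \<delta>" using elim(1) by linarith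
      moreover have "dist (real (exceedances (\<lambda>j. X j \<omega>) n (v n)) / real (k n)) l < \<epsilon>" if "?D \<omega> < a" for \<omega>
      proof -
        have "\<bar>real (exceedances (\<lambda>j. X j \<omega>) n (v n)) / real (k n) - real n * U (v n) / real (k n)\<bar> = ?D \<omega> / real (k n)"
          using elim(3) by (simp add: diff_divide_distrib[symmetric])
        also have "\<dots> < \<epsilon> / 2" using that elim(3) by (simp add: a_def field_simps)
        finally show ?thesis
          using elim(2) dist_triangle_half_r[of "real n * U (v n) / real (k n)"] unfolding dist_real_def
          by (simp add: abs_minus_commute)
      qed
      ultimately show ?case by (intro bexI[of _ "{\<omega> \<in> space M. ?D \<omega> < a}"]) auto
    qed
  qed
qed

text \<open>
  Markov's inequality, with the mean of \<open>max 0 (X j - t)\<close> bounded by a dyadic sum of tail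
  probabilities. The second moment may be infinite, so Chebyshev's inequality is not applicable.
\<close>

lemma prob_total_excess_ge:
  assumes t: "0 < t" and a: "0 < a" and summ: "summable (\<lambda>m. 2 ^ m * U (2 ^ m * t))"
  shows "prob {\<omega> \<in> space M. a \<le> total_excess (\<lambda>j. X j \<omega>) n t}
    \<le> real n * t * (\<Sum>m. 2 ^ m * U (2 ^ m * t)) / a"
proof -
  have U: "0 \<le> U v" for v using X_tail[of 1 v] by (metis measure_nonneg order_refl)
  let ?S = "\<Sum>m. 2 ^ m * U (2 ^ m * t)"
  have S: "0 \<le> ?S" by (intro suminf_nonneg summ) (simp add: U)
  have one: "(\<integral>\<^sup>+\<omega>. ennreal (max 0 (X j \<omega> - t)) \<partial>M) \<le> ennreal (t * ?S)" if j: "j \<ge> 1" for j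
  proof -
    have ev: "{\<omega> \<in> space M. v < X j \<omega>} \<in> sets M" for v using X_meas[OF j] by measurable
    have "(\<integral>\<^sup>+\<omega>. ennreal (max 0 (X j \<omega> - t)) \<partial>M)
        \<le> (\<integral>\<^sup>+\<omega>. (\<Sum>m. ennreal (2 ^ m * t) * indicator {\<omega> \<in> space M. 2 ^ m * t < X j \<omega>} \<omega>) \<partial>M)"
    proof (rule nn_integral_mono)
      fix \<omega> assume \<omega>: "\<omega> \<in> space M"
      obtain M0 where "X j \<omega> / t < 2 ^ M0" using real_arch_pow[of 2 "X j \<omega> / t"] by auto
      then have "X j \<omega> \<le> 2 ^ M0 * t" using t by (simp add: field_simps)
      then have "ennreal (max 0 (X j \<omega> - t)) \<le> ennreal (\<Sum>m<M0. 2 ^ m * t * indicator {2 ^ m * t<..} (X j \<omega>))"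
        using excess_le_dyadic_sum[OF _ t] by (intro ennreal_leI)
      also have "\<dots> = (\<Sum>m<M0. ennreal (2 ^ m * t) * indicator {\<omega> \<in> space M. 2 ^ m * t < X j \<omega>} \<omega>)"
        using t \<omega> by (subst sum_ennreal[symmetric]) (auto intro!: sum.cong simp: indicator_def)
      also have "\<dots> \<le> (\<Sum>m. ennreal (2 ^ m * t) * indicator {\<omega> \<in> space M. 2 ^ m * t < X j \<omega>} \<omega>)"
        by (rule sum_le_suminf) auto
      finally show "ennreal (max 0 (X j \<omega> - t))
        \<le> (\<Sum>m. ennreal (2 ^ m * t) * indicator {\<omega> \<in> space M. 2 ^ m * t < X j \<omega>} \<omega>)" .
    qed
    also have "\<dots> = (\<Sum>m. \<integral>\<^sup>+\<omega>. ennreal (2 ^ m * t) * indicator {\<omega> \<in> space M. 2 ^ m * t < X j \<omega>} \<omega> \<partial>M)"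
      by (rule nn_integral_suminf) (use ev in measurable)
    also have "\<dots> = (\<Sum>m. ennreal (t * (2 ^ m * U (2 ^ m * t))))"
      using ev X_tail[OF j] t U
      by (intro suminf_cong) (simp add: nn_integral_cmult emeasure_eq_measure ennreal_mult'[symmetric] mult_ac)
    also have "\<dots> = ennreal (\<Sum>m. t * (2 ^ m * U (2 ^ m * t)))"
      using t U by (intro suminf_ennreal2 summable_mult summ) auto
    also have "\<dots> = ennreal (t * ?S)" by (simp add: suminf_mult[OF summ])
    finally show ?thesis .
  qed
  have "(\<integral>\<^sup>+\<omega>. ennreal (total_excess (\<lambda>j. X j \<omega>) n t) \<partial>M)
      = (\<integral>\<^sup>+\<omega>. (\<Sum>j=1..n. ennreal (max 0 (X j \<omega> - t))) \<partial>M)"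
    unfolding total_excess_def by (intro nn_integral_cong) (rule sum_ennreal[symmetric], simp)
  also have "\<dots> = (\<Sum>j=1..n. \<integral>\<^sup>+\<omega>. ennreal (max 0 (X j \<omega> - t)) \<partial>M)"
    by (rule nn_integral_sum) (use X_meas in measurable)
  also have "\<dots> \<le> (\<Sum>j=1..n. ennreal (t * ?S))" by (intro sum_mono one) auto
  also have "\<dots> = ennreal (real n * (t * ?S))"
    using t S by (simp add: ennreal_of_nat_eq_real_of_nat ennreal_mult'[symmetric])
  finally have mean: "(\<integral>\<^sup>+\<omega>. ennreal (total_excess (\<lambda>j. X j \<omega>) n t) \<partial>M) \<le> ennreal (real n * (t * ?S))" .
  have scale: "1 \<le> ennreal (1 / a) * ennreal (total_excess (\<lambda>j. X j \<omega>) n t)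
      \<longleftrightarrow> a \<le> total_excess (\<lambda>j. X j \<omega>) n t" for \<omega>
  proof -
    have "ennreal (1 / a) * ennreal (total_excess (\<lambda>j. X j \<omega>) n t) = ennreal (1 / a * total_excess (\<lambda>j. X j \<omega>) n t)"
      using a by (intro ennreal_mult'[symmetric]) simp
    then show ?thesis using a by (simp add: field_simps)
  qed
  have "emeasure M {\<omega> \<in> space M. 1 \<le> ennreal (1 / a) * ennreal (total_excess (\<lambda>j. X j \<omega>) n t)}
     \<le> ennreal (1 / a) * (\<integral>\<^sup>+\<omega>. ennreal (total_excess (\<lambda>j. X j \<omega>) n t) * indicator (space M) \<omega> \<partial>M)"
    by (rule nn_integral_Markov_inequality) measurable
  also have "\<dots> = ennreal (1 / a) * (\<integral>\<^sup>+\<omega>. ennreal (total_excess (\<lambda>j. X j \<omega>) n t) \<partial>M)"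
    by (intro arg_cong2[where f="(*)"] nn_integral_cong) simp_all
  also have "\<dots> \<le> ennreal (1 / a) * ennreal (real n * (t * ?S))" by (intro mult_left_mono mean) auto
  also have "\<dots> = ennreal (real n * t * ?S / a)"
    using a by (simp add: ennreal_mult'[symmetric] mult_ac)
  finally show ?thesis
    using t a S unfolding scale by (simp add: emeasure_eq_measure ennreal_le_iff)
qed

end

section \<open>Order statistics and measurability of the plot\<close>

lemma sorted_desc_nth_greater_iff:
  fixes v :: "'a::linorder"
  assumes "sorted_wrt (\<ge>) xs" "i < length xs"
  shows "v < xs ! i \<longleftrightarrow> i < length (filter (\<lambda>y. v < y) xs)"
  using assms
proof (induction xs arbitrary: i)
  case (Cons y ys)
  show ?case
  proof (cases "v < y")
    case True
    then show ?thesis using Cons by (cases i) auto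
  next
    case False
    then have le: "\<And>z. z \<in> set (y # ys) \<Longrightarrow> \<not> v < z" using Cons.prems(1) by fastforce
    then have "filter (\<lambda>y. v < y) (y # ys) = []" by (simp add: filter_empty_conv)
    moreover have "\<not> v < (y # ys) ! i" using le Cons.prems(2) nth_mem by blast
    ultimately show ?thesis by simp
  qed
qed simp

lemma order_stat_greater_iff:
  assumes "1 \<le> i" "i \<le> n"
  shows "v < order_stat x n i \<longleftrightarrow> i \<le> exceedances x n v"
proof -
  let ?xs = "rev (sort (map x [1..<Suc n]))"
  have "sorted_wrt (\<ge>) ?xs" by (simp add: sorted_wrt_rev)
  then have "v < ?xs ! (i - 1) \<longleftrightarrow> i - 1 < length (filter (\<lambda>y. v < y) ?xs)"
    using assms by (intro sorted_desc_nth_greater_iff) auto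
  also have "length (filter (\<lambda>y. v < y) ?xs) = size (filter_mset (\<lambda>y. v < y) (mset (map x [1..<Suc n])))"
    by (metis mset_filter mset_rev mset_sort size_mset)
  also have "\<dots> = length (filter (\<lambda>j. v < x j) [1..<Suc n])"
    by (metis (no_types, lifting) comp_apply filter_cong filter_map length_map mset_filter size_mset)
  also have "\<dots> = exceedances x n v"
    unfolding exceedances_def by (subst distinct_card[symmetric]) (auto intro!: arg_cong[of _ _ card])
  finally show ?thesis using assms unfolding order_stat_def by auto
qed

lemma order_stat_antimono:
  assumes "1 \<le> i" "i \<le> j" "j \<le> n"
  shows "order_stat x n j \<le> order_stat x n i"
  using order_stat_greater_iff[of i n "order_stat x n i" x] order_stat_greater_iff[of j n "order_stat x n i" x] assms
  by force

lemma nth_beyond_length: "xs ! (length xs + m) = [] ! m"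
  by (induction xs) auto

context iid_sample
begin

text \<open>
  Outside \<open>1 \<le> i \<le> n\<close> the order statistic is still measurable: for \<open>i > n\<close> the list access
  runs past the end and its unspecified value does not depend on the sample, and \<open>i = 0\<close> gives the same
  element as \<open>i = 1\<close>.
\<close>

lemma measurable_order_stat: "(\<lambda>\<omega>. order_stat (\<lambda>j. X j \<omega>) n i) \<in> borel_measurable M"
proof -
  have main: "(\<lambda>\<omega>. order_stat (\<lambda>j. X j \<omega>) n i) \<in> borel_measurable M" if i: "1 \<le> i" for i
  proof (cases "i \<le> n")
    case True
    have "{\<omega> \<in> space M. real i \<le> real (exceedances (\<lambda>j. X j \<omega>) n v)} \<in> sets M" for v
      by measurable
    then show ?thesis
      unfolding borel_measurable_iff_greater order_stat_greater_iff[OF i True] by simp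
  next
    case False
    have "order_stat x n i = [] ! (i - 1 - n)" for x
    proof -
      have "length (rev (sort (map x [1..<Suc n]))) + (i - 1 - n) = i - 1"
        using False by (simp del: upt_Suc)
      then show ?thesis
        unfolding order_stat_def by (metis nth_beyond_length)
    qed
    then show ?thesis by simp
  qed
  show ?thesis
  proof (cases "i = 0")
    case True
    then have "order_stat x n i = order_stat x n 1" for x by (simp add: order_stat_def)
    then show ?thesis using main[of 1] by simp
  qed (use main in auto)
qed

lemma measurable_mean_excess:
  assumes "V \<in> borel_measurable M"
  shows "(\<lambda>\<omega>. mean_excess (\<lambda>j. X j \<omega>) n (V \<omega>)) \<in> borel_measurable M"
  unfolding mean_excess_eq
  by (intro borel_measurable_divide measurable_exceedances measurable_total_excess assms)

lemma mean_excess_plot_eq: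
  "mean_excess_plot x n k =
    (\<lambda>i. (order_stat x n i / order_stat x n k, mean_excess x n (order_stat x n i) / order_stat x n k)) ` {2..k}"
  unfolding mean_excess_plot_def Setcompr_eq_image image_image by (simp add: divide_inverse mult.commute)

lemma measurable_mean_excess_plot:
  "(\<lambda>\<omega>. mean_excess_plot (\<lambda>j. X j \<omega>) n k) \<in> measurable M (borel_sigma fell_topology)"
  unfolding mean_excess_plot_eq
  by (intro measurable_finite_random_set borel_measurable_Pair borel_measurable_divide
      measurable_order_stat measurable_mean_excess) auto

end

section \<open>Weak laws at the scale of the quantile\<close>

locale iid_heavy_tail = iid_sample M X U for M :: "'a measure" and X :: "nat \<Rightarrow> 'a \<Rightarrow> real" and U +
  fixes \<alpha> :: real and k :: "nat \<Rightarrow> nat"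
  assumes \<alpha>: "1 < \<alpha>" and U_rv: "regularly_varying U (- \<alpha>)"
    and k_top: "filterlim k at_top sequentially" and k_ratio: "(\<lambda>n. real (k n) / real n) \<longlonglongrightarrow> 0"
begin

lemma U_antimono: "antimono U"
proof (rule antimonoI)
  fix s t :: real assume "s \<le> t"
  have [measurable]: "X (Suc 0) \<in> borel_measurable M" using X_meas by simp
  have "prob {\<omega> \<in> space M. t < X 1 \<omega>} \<le> prob {\<omega> \<in> space M. s < X 1 \<omega>}"
    using \<open>s \<le> t\<close> by (intro finite_measure_mono) auto
  then show "U t \<le> U s" by (simp add: X_tail)
qed

lemma U_tendsto_0: "(U \<longlongrightarrow> 0) at_top"
proof -
  have [measurable]: "X (Suc 0) \<in> borel_measurable M" using X_meas by simp
  interpret D: real_distribution "distr M borel (X 1)" by (rule real_distribution_distr) (use X_meas in simp)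
  have "U t = 1 - cdf (distr M borel (X 1)) t" for t
  proof -
    have "{\<omega> \<in> space M. t < X 1 \<omega>} = space M - {\<omega> \<in> space M. X 1 \<omega> \<le> t}" by auto
    moreover have "cdf (distr M borel (X 1)) t = prob {\<omega> \<in> space M. X 1 \<omega> \<le> t}"
      unfolding cdf_def by (subst measure_distr) (auto intro!: arg_cong[of _ _ prob])
    ultimately show ?thesis using X_tail[of 1 t] prob_compl[of "{\<omega> \<in> space M. X 1 \<omega> \<le> t}"] by simp
  qed
  then have "U = (\<lambda>t. 1 - cdf (distr M borel (X 1)) t)" by auto
  moreover have "((\<lambda>t. 1 - cdf (distr M borel (X 1)) t) \<longlongrightarrow> 1 - 1) at_top"
    by (intro tendsto_diff tendsto_const D.cdf_lim_at_top_prob)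
  ultimately show ?thesis by simp
qed

definition b :: "nat \<Rightarrow> real" where
  "b n = tail_quantile U (real (k n) / real n)"

lemma k_pos: "\<forall>\<^sub>F n in sequentially. 0 < k n"
  using filterlim_at_top[THEN iffD1, OF k_top, rule_format, of 1] by eventually_elim simp

lemma k_real_top: "filterlim (\<lambda>n. real (k n)) at_top sequentially"
  by (rule filterlim_compose[OF filterlim_real_sequentially k_top])

lemma k_ratio_pos: "\<forall>\<^sub>F n in sequentially. 0 < real (k n) / real n"
  using k_pos eventually_gt_at_top[of 0] by eventually_elim simp

lemma k_le: "\<forall>\<^sub>F n in sequentially. k n \<le> n"
proof -
  have "\<forall>\<^sub>F n in sequentially. real (k n) / real n < 1"
    by (rule order_tendstoD[OF k_ratio]) simp
  with eventually_gt_at_top[of 0] show ?thesis by eventually_elim (simp add: field_simps)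
qed

lemma b_top: "filterlim b at_top sequentially"
  unfolding b_def
  by (rule filterlim_tail_quantile[OF U_antimono U_tendsto_0 regularly_varying_pos[OF U_rv U_antimono] k_ratio k_ratio_pos])

lemma b_pos: "\<forall>\<^sub>F n in sequentially. 0 < b n"
  using b_top unfolding filterlim_at_top_dense by blast

lemma tail_at_b:
  assumes "0 < s"
  shows "(\<lambda>n. real n * U (b n * s) / real (k n)) \<longlonglongrightarrow> s powr - \<alpha>"
  using tail_quantile_asymptotics[OF U_rv U_antimono U_tendsto_0 k_ratio k_ratio_pos assms]
  by (simp add: b_def mult.commute)

definition count_ratio :: "real \<Rightarrow> nat \<times> 'a \<Rightarrow> real" where
  "count_ratio u = (\<lambda>(n, \<omega>). real (exceedances (\<lambda>j. X j \<omega>) n (b n * u)) / real (k n))"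

definition excess_ratio :: "real \<Rightarrow> nat \<times> 'a \<Rightarrow> real" where
  "excess_ratio u = (\<lambda>(n, \<omega>). total_excess (\<lambda>j. X j \<omega>) n (b n * u) / (b n * real (k n)))"

definition threshold_ratio :: "nat \<times> 'a \<Rightarrow> real" where
  "threshold_ratio = (\<lambda>(n, \<omega>). order_stat (\<lambda>j. X j \<omega>) n (k n) / b n)"

lemma scaling_whp: "\<forall>\<^sub>F x in whp M. 0 < b (fst x) \<and> 0 < k (fst x) \<and> k (fst x) \<le> fst x"
proof -
  have "\<forall>\<^sub>F n in sequentially. 0 < b n \<and> 0 < k n \<and> k n \<le> n"
    using b_pos k_pos k_le by eventually_elim simp
  then show ?thesis using filterlim_fst_whp unfolding filterlim_iff by blast
qed

lemma count_ratio_tendsto: "0 < u \<Longrightarrow> (count_ratio u \<longlongrightarrow> u powr - \<alpha>) (whp M)"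
  unfolding count_ratio_def by (intro exceedances_tendsto tail_at_b k_top)

lemma excess_ratio_diff_bounds:
  assumes "0 < b n" "0 < k n" "u \<le> w"
  shows "(w - u) * count_ratio w (n, \<omega>) \<le> excess_ratio u (n, \<omega>) - excess_ratio w (n, \<omega>)"
    and "excess_ratio u (n, \<omega>) - excess_ratio w (n, \<omega>) \<le> (w - u) * count_ratio u (n, \<omega>)"
proof -
  let ?T = "\<lambda>u. total_excess (\<lambda>j. X j \<omega>) n (b n * u)" and ?N = "\<lambda>u. real (exceedances (\<lambda>j. X j \<omega>) n (b n * u))"
  have le: "b n * u \<le> b n * w" using assms by simp
  have eq: "excess_ratio u (n, \<omega>) - excess_ratio w (n, \<omega>) = (?T u - ?T w) / (b n * real (k n))"
    by (simp add: excess_ratio_def diff_divide_distrib)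
  have cr: "(w - u) * count_ratio v (n, \<omega>) = ((b n * w - b n * u) * ?N v) / (b n * real (k n))" for v
    using assms by (simp add: count_ratio_def right_diff_distrib[symmetric])
  have pos: "0 \<le> b n * real (k n)" using assms by simp
  show "(w - u) * count_ratio w (n, \<omega>) \<le> excess_ratio u (n, \<omega>) - excess_ratio w (n, \<omega>)"
    unfolding eq cr[of w] by (intro divide_right_mono total_excess_diff_bounds le pos)
  show "excess_ratio u (n, \<omega>) - excess_ratio w (n, \<omega>) \<le> (w - u) * count_ratio u (n, \<omega>)"
    unfolding eq cr[of u] by (intro divide_right_mono total_excess_diff_bounds le pos)
qed

text \<open>
  The bound from Markov's inequality tends to a multiple of \<open>L powr (1 - \<alpha>)\<close>, which vanishes for
  large \<open>L\<close> because \<open>\<alpha> > 1\<close>.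
\<close>

lemma excess_ratio_tail_small:
  assumes "0 < \<epsilon>" "0 < \<delta>"
  shows "\<forall>\<^sub>F L in at_top. \<forall>\<^sub>F n in sequentially. prob {\<omega> \<in> space M. \<epsilon> \<le> excess_ratio L (n, \<omega>)} < \<delta>"
proof -
  obtain C t0 where C: "0 < C" "0 < t0"
    "\<And>t. t0 \<le> t \<Longrightarrow> summable (\<lambda>m. 2 ^ m * U (2 ^ m * t))"
    "\<And>t. t0 \<le> t \<Longrightarrow> (\<Sum>m. 2 ^ m * U (2 ^ m * t)) \<le> C * U t"
    by (rule dyadic_tail_sum[OF U_rv U_antimono]) (use \<alpha> in auto)
  have "((\<lambda>L. L powr (1 - \<alpha>) * (C / \<epsilon>)) \<longlongrightarrow> 0 * (C / \<epsilon>)) at_top"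
    using \<alpha> by (intro tendsto_mult_right tendsto_neg_powr filterlim_ident) auto
  then have "\<forall>\<^sub>F L in at_top. L powr (1 - \<alpha>) * (C / \<epsilon>) < \<delta>"
    by (rule order_tendstoD) (use assms in simp)
  then show ?thesis using eventually_gt_at_top[of 0]
  proof eventually_elim
    case (elim L)
    have "(\<lambda>n. real n * U (b n * L) / real (k n) * (L * C / \<epsilon>)) \<longlonglongrightarrow> L powr - \<alpha> * (L * C / \<epsilon>)"
      by (intro tendsto_mult_right tail_at_b elim)
    moreover have "L powr - \<alpha> * (L * C / \<epsilon>) = L powr (1 - \<alpha>) * (C / \<epsilon>)"
      using elim(2) powr_add[of L "- \<alpha>" 1] by (simp add: add.commute)
    ultimately have "\<forall>\<^sub>F n in sequentially. real n * U (b n * L) / real (k n) * (L * C / \<epsilon>) < \<delta>"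
      using elim(1) by (metis order_tendstoD(2))
    moreover have "\<forall>\<^sub>F n in sequentially. t0 / L \<le> b n"
      using b_top unfolding filterlim_at_top by blast
    ultimately show ?case using b_pos k_pos
    proof eventually_elim
      case (elim n)
      have t: "t0 \<le> b n * L" using elim(2) \<open>0 < L\<close> by (simp add: field_simps)
      have pos: "0 < b n * L" "0 < \<epsilon> * (b n * real (k n))" using elim \<open>0 < L\<close> assms by auto
      have "{\<omega> \<in> space M. \<epsilon> \<le> excess_ratio L (n, \<omega>)}
          = {\<omega> \<in> space M. \<epsilon> * (b n * real (k n)) \<le> total_excess (\<lambda>j. X j \<omega>) n (b n * L)}"
        using elim by (simp add: excess_ratio_def pos_le_divide_eq)
      then have "prob {\<omega> \<in> space M. \<epsilon> \<le> excess_ratio L (n, \<omega>)}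
          \<le> real n * (b n * L) * (\<Sum>m. 2 ^ m * U (2 ^ m * (b n * L))) / (\<epsilon> * (b n * real (k n)))"
        using prob_total_excess_ge[OF pos C(3)[OF t]] by simp
      also have "\<dots> \<le> real n * (b n * L) * (C * U (b n * L)) / (\<epsilon> * (b n * real (k n)))"
        using pos by (intro divide_right_mono mult_left_mono C(4)[OF t]) auto
      also have "\<dots> = real n * U (b n * L) / real (k n) * (L * C / \<epsilon>)"
        using elim assms by (simp add: field_simps)
      finally show ?case using elim(1) by linarith
    qed
  qed
qed

text \<open>
  The increments of the total excess over the grid \<open>u * r ^ m\<close>, \<open>m \<le> J\<close>, lie between finite linear
  combinations of exceedance counts, which converge to the Riemann sums of \<open>s powr - \<alpha>\<close>. The excess
  beyond the last grid point is small with probability at least \<open>1 - \<delta>\<close> when \<open>J\<close> is large.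
\<close>

lemma excess_ratio_tendsto:
  assumes u: "0 < u"
  shows "(excess_ratio u \<longlongrightarrow> u powr (1 - \<alpha>) / (\<alpha> - 1)) (whp M)"
proof (rule tendstoI, rule whp_mono_approx)
  fix \<epsilon> \<delta> :: real assume \<epsilon>: "0 < \<epsilon>" and \<delta>: "0 < \<delta>"
  define l where "l = u powr (1 - \<alpha>) / (\<alpha> - 1)"
  obtain r where r: "1 < r"
    "\<forall>\<^sub>F J in sequentially. l - \<epsilon> / 4 < (\<Sum>m<J. (u * r ^ Suc m - u * r ^ m) * (u * r ^ Suc m) powr - \<alpha>)"
    "\<And>J. (\<Sum>m<J. (u * r ^ Suc m - u * r ^ m) * (u * r ^ m) powr - \<alpha>) < l + \<epsilon> / 4"
    unfolding l_def by (rule geometric_riemann_sums[OF \<alpha> u, of "\<epsilon> / 4"]) (use \<epsilon> in auto)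
  have "filterlim (\<lambda>J. u * r ^ J) at_top sequentially"
    using u r(1)
    by (intro filterlim_tendsto_pos_mult_at_top[OF tendsto_const] filterlim_at_infinity_imp_filterlim_at_top
        filterlim_realpow_sequentially_gt1) auto
  then have "\<forall>\<^sub>F J in sequentially. \<forall>\<^sub>F n in sequentially. prob {\<omega> \<in> space M. \<epsilon> / 2 \<le> excess_ratio (u * r ^ J) (n, \<omega>)} < \<delta>"
    by (rule eventually_compose_filterlim[OF excess_ratio_tail_small, rotated 2]) (use \<epsilon> \<delta> in auto)
  with r(2) have "\<forall>\<^sub>F J in sequentially. l - \<epsilon> / 4 < (\<Sum>m<J. (u * r ^ Suc m - u * r ^ m) * (u * r ^ Suc m) powr - \<alpha>)
      \<and> (\<forall>\<^sub>F n in sequentially. prob {\<omega> \<in> space M. \<epsilon> / 2 \<le> excess_ratio (u * r ^ J) (n, \<omega>)} < \<delta>)"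
    by (rule eventually_conj)
  then obtain J where J: "l - \<epsilon> / 4 < (\<Sum>m<J. (u * r ^ Suc m - u * r ^ m) * (u * r ^ Suc m) powr - \<alpha>)"
      "\<forall>\<^sub>F n in sequentially. prob {\<omega> \<in> space M. \<epsilon> / 2 \<le> excess_ratio (u * r ^ J) (n, \<omega>)} < \<delta>"
    using eventually_happens'[OF sequentially_bot] by blast
  define low where "low = (\<lambda>x. \<Sum>m<J. (u * r ^ Suc m - u * r ^ m) * count_ratio (u * r ^ Suc m) x)"
  define up where "up = (\<lambda>x. \<Sum>m<J. (u * r ^ Suc m - u * r ^ m) * count_ratio (u * r ^ m) x)"
  have grid: "0 < u * r ^ m" for m using u r(1) by simp
  have mono: "u * r ^ m \<le> u * r ^ Suc m" for m using u r(1) by simp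
  have "\<forall>\<^sub>F x in whp M. l - \<epsilon> / 4 < low x"
    unfolding low_def by (rule order_tendstoD[OF _ J(1)]) (intro tendsto_sum tendsto_mult_left count_ratio_tendsto grid)
  moreover have "\<forall>\<^sub>F x in whp M. up x < l + \<epsilon> / 4"
    unfolding up_def by (rule order_tendstoD(2)[OF _ r(3)[of J]]) (intro tendsto_sum tendsto_mult_left count_ratio_tendsto grid)
  ultimately have "\<forall>\<^sub>F x in whp M. l - \<epsilon> / 4 < low x \<and> up x < l + \<epsilon> / 4 \<and> 0 < b (fst x) \<and> 0 < k (fst x)"
    using scaling_whp by eventually_elim simp
  moreover have "\<forall>\<^sub>F n in sequentially. \<exists>A\<in>sets M. prob (space M - A) < \<delta> \<and>
      (\<forall>\<omega>\<in>A. l - \<epsilon> / 4 < low (n, \<omega>) \<and> up (n, \<omega>) < l + \<epsilon> / 4 \<and> 0 < b (fst (n, \<omega>)) \<and> 0 < k (fst (n, \<omega>))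
        \<longrightarrow> dist (excess_ratio u (n, \<omega>)) l < \<epsilon>)"
    using J(2) b_pos
  proof eventually_elim
    case (elim n)
    let ?A = "{\<omega> \<in> space M. excess_ratio (u * r ^ J) (n, \<omega>) < \<epsilon> / 2}"
    have "space M - ?A = {\<omega> \<in> space M. \<epsilon> / 2 \<le> excess_ratio (u * r ^ J) (n, \<omega>)}" by auto
    moreover have "?A \<in> sets M" unfolding excess_ratio_def prod.case by measurable
    moreover have "dist (excess_ratio u (n, \<omega>)) l < \<epsilon>"
      if A: "\<omega> \<in> ?A" and *: "l - \<epsilon> / 4 < low (n, \<omega>)" "up (n, \<omega>) < l + \<epsilon> / 4" "0 < k n" for \<omega>
    proof -
      let ?E = "\<lambda>m. excess_ratio (u * r ^ m) (n, \<omega>)"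
      have tel: "(\<Sum>m<J. ?E m - ?E (Suc m)) = ?E 0 - ?E J" by (rule sum_lessThan_telescope')
      have "low (n, \<omega>) \<le> (\<Sum>m<J. ?E m - ?E (Suc m))"
        unfolding low_def by (intro sum_mono excess_ratio_diff_bounds elim * mono)
      moreover have "(\<Sum>m<J. ?E m - ?E (Suc m)) \<le> up (n, \<omega>)"
        unfolding up_def by (intro sum_mono excess_ratio_diff_bounds elim * mono)
      moreover have "0 \<le> ?E J"
        using elim(2) total_excess_nonneg by (simp add: excess_ratio_def)
      moreover have "?E J < \<epsilon> / 2" using A by simp
      ultimately have "l - \<epsilon> / 4 < excess_ratio u (n, \<omega>)" "excess_ratio u (n, \<omega>) < l + \<epsilon> / 4 + \<epsilon> / 2"
        using * tel by simp_all
      then show ?thesis using \<epsilon> by (simp add: dist_real_def abs_less_iff)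
    qed
    ultimately show ?case using elim(1) by (intro bexI[of _ ?A]) auto
  qed
  ultimately show "\<exists>Q. eventually Q (whp M) \<and> (\<forall>\<^sub>F n in sequentially. \<exists>A\<in>sets M. prob (space M - A) < \<delta> \<and>
      (\<forall>\<omega>\<in>A. Q (n, \<omega>) \<longrightarrow> dist (excess_ratio u (n, \<omega>)) (u powr (1 - \<alpha>) / (\<alpha> - 1)) < \<epsilon>))"
    unfolding l_def[symmetric] by blast
qed

text \<open>
  For \<open>a < 1\<close> there are about \<open>a powr - \<alpha> * k n > k n\<close> observations above \<open>b n * a\<close>, which puts the
  \<open>k n\<close>-th largest above it as well; for \<open>a > 1\<close> there are too few.
\<close>

lemma threshold_ratio_tendsto: "(threshold_ratio \<longlongrightarrow> 1) (whp M)"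
proof (rule order_tendstoI)
  fix a :: real assume "a < 1"
  define a' where "a' = max a (1 / 2)"
  have a': "0 < a'" "a' < 1" "a \<le> a'" using \<open>a < 1\<close> by (auto simp: a'_def)
  have "1 < a' powr - \<alpha>" using a' \<alpha> powr_less_mono2_neg[of "- \<alpha>" a' 1] by simp
  then have "\<forall>\<^sub>F x in whp M. 1 < count_ratio a' x"
    by (rule order_tendstoD[OF count_ratio_tendsto[OF a'(1)]])
  then show "\<forall>\<^sub>F x in whp M. a < threshold_ratio x"
    using scaling_whp
  proof eventually_elim
    case (elim x)
    obtain n \<omega> where x: "x = (n, \<omega>)" by (cases x)
    have "k n \<le> exceedances (\<lambda>j. X j \<omega>) n (b n * a')"
      using elim by (simp add: x count_ratio_def)
    then have "b n * a' < order_stat (\<lambda>j. X j \<omega>) n (k n)"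
      using elim by (subst order_stat_greater_iff) (auto simp: x)
    then have "a' < threshold_ratio x" using elim by (simp add: x threshold_ratio_def field_simps)
    then show ?case using a' by linarith
  qed
next
  fix a :: real assume "1 < a"
  then obtain a' where a': "1 < a'" "a' < a" using dense by blast
  have "a' powr - \<alpha> < 1" using a' \<alpha> powr_less_mono2_neg[of "- \<alpha>" 1 a'] by simp
  then have "\<forall>\<^sub>F x in whp M. count_ratio a' x < 1"
    using a' by (intro order_tendstoD[OF count_ratio_tendsto]) auto
  then show "\<forall>\<^sub>F x in whp M. threshold_ratio x < a"
    using scaling_whp
  proof eventually_elim
    case (elim x)
    obtain n \<omega> where x: "x = (n, \<omega>)" by (cases x)
    have "\<not> k n \<le> exceedances (\<lambda>j. X j \<omega>) n (b n * a')"
      using elim by (simp add: x count_ratio_def)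
    then have "\<not> b n * a' < order_stat (\<lambda>j. X j \<omega>) n (k n)"
      using elim by (subst order_stat_greater_iff) (auto simp: x)
    then have "threshold_ratio x \<le> a'" using elim by (simp add: x threshold_ratio_def field_simps)
    then show ?case using a' by linarith
  qed
qed

section \<open>Convergence of the mean excess plot\<close>

definition plot_point :: "nat \<times> 'a \<Rightarrow> nat \<Rightarrow> real \<times> real" where
  "plot_point = (\<lambda>(n, \<omega>) i.
     (order_stat (\<lambda>j. X j \<omega>) n i / order_stat (\<lambda>j. X j \<omega>) n (k n),
      mean_excess (\<lambda>j. X j \<omega>) n (order_stat (\<lambda>j. X j \<omega>) n i) / order_stat (\<lambda>j. X j \<omega>) n (k n)))"

text \<open>
  If \<open>X\<^sub>(\<^sub>i\<^sub>)\<close> lies between \<open>b n * u1\<close> and \<open>b n * u2\<close>, monotonicity bounds its mean excess by quotients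
  of a total excess at one of these thresholds and a count at the other. Their limits are close to
  \<open>t / (\<alpha> - 1)\<close> once \<open>u1\<close> and \<open>u2\<close> are close to \<open>t\<close>. The bounds hold for all \<open>i\<close> at once, although
  the thresholds \<open>X\<^sub>(\<^sub>i\<^sub>)\<close> are random.
\<close>

lemma plot_points_near_line:
  assumes t: "1 \<le> t" and l: "l < t / (\<alpha> - 1)" and h: "t / (\<alpha> - 1) < h"
  obtains a1 a2 where "a1 < t" "t < a2"
    "\<forall>\<^sub>F x in whp M. \<forall>i. a1 < fst (plot_point x i) \<and> fst (plot_point x i) < a2 \<longrightarrow>
      l < snd (plot_point x i) \<and> snd (plot_point x i) < h"
proof -
  have "((\<lambda>s. (t - s) powr (1 - \<alpha>) / (\<alpha> - 1) / (t + s) powr - \<alpha>) \<longlongrightarrow>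
        (t - 0) powr (1 - \<alpha>) / (\<alpha> - 1) / (t + 0) powr - \<alpha>) (at_right 0)"
    using t \<alpha> by (intro tendsto_intros) auto
  moreover have "((\<lambda>s. (t + s) powr (1 - \<alpha>) / (\<alpha> - 1) / (t - s) powr - \<alpha>) \<longlongrightarrow>
        (t + 0) powr (1 - \<alpha>) / (\<alpha> - 1) / (t - 0) powr - \<alpha>) (at_right 0)"
    using t \<alpha> by (intro tendsto_intros) auto
  moreover have "t powr (1 - \<alpha>) / (\<alpha> - 1) / t powr - \<alpha> = t / (\<alpha> - 1)"
  proof -
    have "t powr (1 - \<alpha>) = t * t powr - \<alpha>" using t powr_add[of t 1 "- \<alpha>"] by simp
    then show ?thesis using t by simp
  qed
  ultimately have "\<forall>\<^sub>F s in at_right 0. (t - s) powr (1 - \<alpha>) / (\<alpha> - 1) / (t + s) powr - \<alpha> < h"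
    "\<forall>\<^sub>F s in at_right 0. l < (t + s) powr (1 - \<alpha>) / (\<alpha> - 1) / (t - s) powr - \<alpha>"
    using l h by (auto intro: order_tendstoD)
  moreover have "\<forall>\<^sub>F s in at_right (0::real). 0 < s \<and> s < 1"
    by (rule eventually_at_rightI[of 0 1]) auto
  ultimately have "\<forall>\<^sub>F s in at_right 0. (t - s) powr (1 - \<alpha>) / (\<alpha> - 1) / (t + s) powr - \<alpha> < h \<and>
    l < (t + s) powr (1 - \<alpha>) / (\<alpha> - 1) / (t - s) powr - \<alpha> \<and> 0 < s \<and> s < 1"
    by eventually_elim simp
  then obtain s where s: "(t - s) powr (1 - \<alpha>) / (\<alpha> - 1) / (t + s) powr - \<alpha> < h"
    "l < (t + s) powr (1 - \<alpha>) / (\<alpha> - 1) / (t - s) powr - \<alpha>" "0 < s" "s < 1"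
    by (auto dest!: eventually_happens'[rotated])
  \<comment> \<open>the window \<open>(a1, a2)\<close> is strictly inside \<open>(u1, u2)\<close> to leave room for replacing
    \<open>X\<^sub>(\<^sub>k\<^sub>)\<close> by \<open>b n\<close>\<close>
  define u1 u2 a1 a2 where u: "u1 = t - s" "u2 = t + s" "a1 = t - s / 2" "a2 = t + s / 2"
  have pos: "0 < u1" "0 < u2" using s t by (auto simp: u)
  have "((\<lambda>x. excess_ratio u1 x / count_ratio u2 x / threshold_ratio x) \<longlongrightarrow> u1 powr (1 - \<alpha>) / (\<alpha> - 1) / u2 powr - \<alpha> / 1) (whp M)"
    using pos by (intro tendsto_divide excess_ratio_tendsto count_ratio_tendsto threshold_ratio_tendsto) auto
  then have "\<forall>\<^sub>F x in whp M. excess_ratio u1 x / count_ratio u2 x / threshold_ratio x < h"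
    by (rule order_tendstoD) (use s in \<open>simp add: u\<close>)
  moreover have "((\<lambda>x. excess_ratio u2 x / count_ratio u1 x / threshold_ratio x) \<longlongrightarrow> u2 powr (1 - \<alpha>) / (\<alpha> - 1) / u1 powr - \<alpha> / 1) (whp M)"
    using pos by (intro tendsto_divide excess_ratio_tendsto count_ratio_tendsto threshold_ratio_tendsto) auto
  then have "\<forall>\<^sub>F x in whp M. l < excess_ratio u2 x / count_ratio u1 x / threshold_ratio x"
    by (rule order_tendstoD) (use s in \<open>simp add: u\<close>)
  moreover have "\<forall>\<^sub>F x in whp M. 0 < count_ratio u2 x"
    by (rule order_tendstoD[OF count_ratio_tendsto]) (use pos in auto)
  moreover have "\<forall>\<^sub>F x in whp M. 0 < threshold_ratio x"
    by (rule order_tendstoD[OF threshold_ratio_tendsto]) auto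
  moreover have "((\<lambda>x. a1 * threshold_ratio x) \<longlongrightarrow> a1 * 1) (whp M)" "((\<lambda>x. a2 * threshold_ratio x) \<longlongrightarrow> a2 * 1) (whp M)"
    by (intro tendsto_mult_left threshold_ratio_tendsto)+
  then have "\<forall>\<^sub>F x in whp M. u1 < a1 * threshold_ratio x" "\<forall>\<^sub>F x in whp M. a2 * threshold_ratio x < u2"
    using s by (auto intro!: order_tendstoD simp: u)
  ultimately have ev: "\<forall>\<^sub>F x in whp M. \<forall>i. a1 < fst (plot_point x i) \<and> fst (plot_point x i) < a2 \<longrightarrow>
      l < snd (plot_point x i) \<and> snd (plot_point x i) < h"
    using scaling_whp
  proof eventually_elim
    case (elim x)
    obtain n \<omega> where x: "x = (n, \<omega>)" by (cases x)
    let ?x = "\<lambda>j. X j \<omega>"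
    let ?Q = "threshold_ratio x" and ?T = "order_stat ?x n (k n)"
    have T: "?T = ?Q * b n" using elim by (simp add: x threshold_ratio_def)
    have Tpos: "0 < ?T" using elim by (simp add: T x)
    have bk: "0 < b n" "0 < k n" using elim by (auto simp: x)
    show ?case
    proof (intro allI impI)
      fix i assume i: "a1 < fst (plot_point x i) \<and> fst (plot_point x i) < a2"
      let ?v = "order_stat ?x n i"
      have "a1 * ?T < ?v" "?v < a2 * ?T"
        using i Tpos by (auto simp: plot_point_def x field_simps)
      moreover have "b n * u1 \<le> a1 * ?T" "a2 * ?T \<le> b n * u2"
        using elim bk by (auto simp: T mult_ac intro!: mult_left_mono simp del: mult_le_cancel_left_pos)
      ultimately have v: "b n * u1 \<le> ?v" "?v \<le> b n * u2" by linarith+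
      have cnt: "0 < real (exceedances ?x n (b n * u2))"
        using elim bk by (simp add: count_ratio_def x zero_less_divide_iff)
      have m1: "real (exceedances ?x n (b n * u2)) \<le> real (exceedances ?x n ?v)"
        "real (exceedances ?x n ?v) \<le> real (exceedances ?x n (b n * u1))"
        using exceedances_antimono v by auto
      have m2: "total_excess ?x n (b n * u2) \<le> total_excess ?x n ?v"
        "total_excess ?x n ?v \<le> total_excess ?x n (b n * u1)"
        using total_excess_antimono v by auto
      have "mean_excess ?x n ?v \<le> total_excess ?x n (b n * u1) / real (exceedances ?x n (b n * u2))"
        unfolding mean_excess_eq using cnt m1 m2 total_excess_nonneg by (intro frac_le) auto
      then have "mean_excess ?x n ?v / ?T \<le> total_excess ?x n (b n * u1) / real (exceedances ?x n (b n * u2)) / ?T"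
        using Tpos by (intro divide_right_mono) auto
      also have "\<dots> = excess_ratio u1 x / count_ratio u2 x / ?Q"
        using bk by (simp add: excess_ratio_def count_ratio_def x T)
      finally have hi: "mean_excess ?x n ?v / ?T < h" using elim by simp
      have "total_excess ?x n (b n * u2) / real (exceedances ?x n (b n * u1)) \<le> mean_excess ?x n ?v"
        unfolding mean_excess_eq using cnt m1 m2 total_excess_nonneg by (intro frac_le) auto
      then have "total_excess ?x n (b n * u2) / real (exceedances ?x n (b n * u1)) / ?T \<le> mean_excess ?x n ?v / ?T"
        using Tpos by (intro divide_right_mono) auto
      moreover have "total_excess ?x n (b n * u2) / real (exceedances ?x n (b n * u1)) / ?T
          = excess_ratio u2 x / count_ratio u1 x / ?Q"
        using bk by (simp add: excess_ratio_def count_ratio_def x T)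
      ultimately have lo: "l < mean_excess ?x n ?v / ?T" using elim by simp
      show "l < snd (plot_point x i) \<and> snd (plot_point x i) < h" using lo hi by (simp add: plot_point_def x)
    qed
  qed
  show ?thesis by (rule that[OF _ _ ev]) (use s in \<open>auto simp: u\<close>)
qed

text \<open>
  The index is the number of exceedances of \<open>b n * u1\<close>, with \<open>t < u1 < u2 < d\<close>: the corresponding order
  statistic is the smallest observation above \<open>b n * u1\<close>, and it is at most \<open>b n * u2\<close> because fewer
  observations exceed the latter. As \<open>u1 > 1\<close>, this index is at most \<open>k n\<close>.
\<close>

lemma plot_point_in_window:
  assumes t: "1 \<le> t" "t < d"
  shows "\<forall>\<^sub>F x in whp M. \<exists>i\<in>{2..k (fst x)}. t < fst (plot_point x i) \<and> fst (plot_point x i) < d"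
proof -
  obtain u1 where u1: "t < u1" "u1 < d" using t dense by blast
  obtain u2 where u2: "u1 < u2" "u2 < d" using u1 dense by blast
  have pos: "0 < u1" "0 < u2" using u1 u2 t by auto
  have p1: "u1 powr - \<alpha> < 1" using u1 t \<alpha> powr_less_mono2_neg[of "- \<alpha>" 1 u1] by simp
  have p2: "u2 powr - \<alpha> < u1 powr - \<alpha>" using pos u2 \<alpha> by (intro powr_less_mono2_neg) auto
  have "\<forall>\<^sub>F x in whp M. count_ratio u1 x < 1"
    by (rule order_tendstoD(2)[OF count_ratio_tendsto[OF pos(1)] p1])
  moreover have "\<forall>\<^sub>F x in whp M. u1 powr - \<alpha> / 2 < count_ratio u1 x"
    by (rule order_tendstoD[OF count_ratio_tendsto[OF pos(1)]]) (use pos in simp)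
  moreover have "((\<lambda>x. count_ratio u1 x - count_ratio u2 x) \<longlongrightarrow> u1 powr - \<alpha> - u2 powr - \<alpha>) (whp M)"
    by (intro tendsto_diff count_ratio_tendsto pos)
  then have "\<forall>\<^sub>F x in whp M. 0 < count_ratio u1 x - count_ratio u2 x"
    by (rule order_tendstoD) (use p2 in simp)
  moreover have "((\<lambda>x. t * threshold_ratio x) \<longlongrightarrow> t * 1) (whp M)" "((\<lambda>x. d * threshold_ratio x) \<longlongrightarrow> d * 1) (whp M)"
    by (intro tendsto_mult_left threshold_ratio_tendsto)+
  then have "\<forall>\<^sub>F x in whp M. t * threshold_ratio x < u1" "\<forall>\<^sub>F x in whp M. u2 < d * threshold_ratio x"
    using u1 u2 by (auto intro!: order_tendstoD)
  moreover have "\<forall>\<^sub>F x in whp M. 0 < threshold_ratio x"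
    by (rule order_tendstoD[OF threshold_ratio_tendsto]) auto
  moreover have "\<forall>\<^sub>F n in sequentially. 4 / u1 powr - \<alpha> \<le> real (k n)"
    using k_real_top unfolding filterlim_at_top by blast
  then have "\<forall>\<^sub>F x in whp M. 4 / u1 powr - \<alpha> \<le> real (k (fst x))"
    using filterlim_fst_whp unfolding filterlim_iff by blast
  ultimately show ?thesis using scaling_whp
  proof eventually_elim
    case (elim x)
    obtain n \<omega> where x: "x = (n, \<omega>)" by (cases x)
    let ?x = "\<lambda>j. X j \<omega>"
    let ?Q = "threshold_ratio x" and ?T = "order_stat ?x n (k n)"
    have T: "?T = ?Q * b n" using elim by (simp add: x threshold_ratio_def)
    have Tpos: "0 < ?T" using elim by (simp add: T x)
    have bk: "0 < b n" "0 < k n" "k n \<le> n" using elim by (auto simp: x)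
    define i where "i = exceedances ?x n (b n * u1)"
    have c1: "count_ratio u1 x = real i / real (k n)" by (simp add: count_ratio_def x i_def)
    have "u1 powr - \<alpha> / 2 * real (k n) < real i" using elim(2) bk unfolding c1 by (simp add: field_simps)
    moreover have "2 \<le> u1 powr - \<alpha> / 2 * real (k n)" using elim(7) pos by (simp add: x field_simps)
    ultimately have "2 \<le> i" by linarith
    have "i \<le> k n" using elim(1) bk unfolding c1 by (simp add: field_simps)
    have "exceedances ?x n (b n * u2) < i"
      using elim(3) bk unfolding c1 by (simp add: count_ratio_def x field_simps)
    then have "\<not> b n * u2 < order_stat ?x n i" "b n * u1 < order_stat ?x n i"
      using \<open>2 \<le> i\<close> \<open>i \<le> k n\<close> bk by (auto simp: order_stat_greater_iff i_def)
    moreover have "t * ?T < b n * u1" "b n * u2 < d * ?T"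
      using elim bk by (auto simp: T mult_ac mult_strict_left_mono)
    ultimately have "t < fst (plot_point x i) \<and> fst (plot_point x i) < d"
      using Tpos by (simp add: plot_point_def x field_simps)
    then show ?case using \<open>2 \<le> i\<close> \<open>i \<le> k n\<close> by (intro bexI[of _ i]) (auto simp: x)
  qed
qed

lemma plot_points_right_of_1:
  "\<forall>\<^sub>F x in whp M. \<forall>i\<in>{2..k (fst x)}. 1 \<le> fst (plot_point x i)"
proof -
  have "\<forall>\<^sub>F x in whp M. 0 < threshold_ratio x"
    by (rule order_tendstoD[OF threshold_ratio_tendsto]) auto
  then show ?thesis using scaling_whp
  proof eventually_elim
    case (elim x)
    obtain n \<omega> where x: "x = (n, \<omega>)" by (cases x)
    let ?x = "\<lambda>j. X j \<omega>"
    have "0 < order_stat ?x n (k n)"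
      using elim by (simp add: x threshold_ratio_def zero_less_divide_iff)
    moreover have "order_stat ?x n (k n) \<le> order_stat ?x n i" if "i \<in> {2..k n}" for i
      using that elim by (intro order_stat_antimono) (auto simp: x)
    ultimately show ?case by (simp add: plot_point_def x)
  qed
qed

definition limit_line :: "(real \<times> real) set" where
  "limit_line = {(t, t / (\<alpha> - 1)) | t. 1 \<le> t}"

text \<open>
  Points to the left of the vertical line through 1 are avoided because the plot is normalised by its
  smallest abscissa, and points above or below the line because of \<open>plot_points_near_line\<close>.
\<close>

lemma plot_misses_neighbourhood:
  assumes "p \<notin> limit_line"
  obtains V where "open V" "p \<in> V" "\<forall>\<^sub>F x in whp M. plot_point x ` {2..k (fst x)} \<inter> V = {}"
proof -
  have miss: "f ` I \<inter> S = {} \<longleftrightarrow> (\<forall>i\<in>I. f i \<notin> S)"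
    for f :: "nat \<Rightarrow> real \<times> real" and I S by blast
  obtain t m where p: "p = (t, m)" by (cases p)
  consider "t < 1" | "1 \<le> t" "t / (\<alpha> - 1) < m" | "1 \<le> t" "m < t / (\<alpha> - 1)"
    using assms unfolding p limit_line_def by fastforce
  then show ?thesis
  proof cases
    case 1
    have "\<forall>\<^sub>F x in whp M. plot_point x ` {2..k (fst x)} \<inter> ({..<1} \<times> UNIV) = {}"
      using plot_points_right_of_1
      unfolding miss mem_Times_iff by eventually_elim force
    then show ?thesis using 1 p by (intro that[of "{..<1} \<times> UNIV"]) (auto intro: open_Times)
  next
    case 2
    obtain h where h: "t / (\<alpha> - 1) < h" "h < m" using 2(2) dense by blast
    obtain a1 a2 where a: "a1 < t" "t < a2"
      "\<forall>\<^sub>F x in whp M. \<forall>i. a1 < fst (plot_point x i) \<and> fst (plot_point x i) < a2 \<longrightarrow>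
        t / (\<alpha> - 1) - 1 < snd (plot_point x i) \<and> snd (plot_point x i) < h"
      using plot_points_near_line[OF 2(1) _ h(1), of "t / (\<alpha> - 1) - 1"] by auto
    have "\<forall>\<^sub>F x in whp M. plot_point x ` {2..k (fst x)} \<inter> ({a1<..<a2} \<times> {h<..}) = {}"
      using a(3) unfolding miss mem_Times_iff by eventually_elim force
    then show ?thesis using a h p by (intro that[of "{a1<..<a2} \<times> {h<..}"]) (auto intro: open_Times)
  next
    case 3
    obtain l where l: "m < l" "l < t / (\<alpha> - 1)" using 3(2) dense by blast
    obtain a1 a2 where a: "a1 < t" "t < a2"
      "\<forall>\<^sub>F x in whp M. \<forall>i. a1 < fst (plot_point x i) \<and> fst (plot_point x i) < a2 \<longrightarrow>
        l < snd (plot_point x i) \<and> snd (plot_point x i) < t / (\<alpha> - 1) + 1"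
      using plot_points_near_line[OF 3(1) l(2), of "t / (\<alpha> - 1) + 1"] by auto
    have "\<forall>\<^sub>F x in whp M. plot_point x ` {2..k (fst x)} \<inter> ({a1<..<a2} \<times> {..<l}) = {}"
      using a(3) unfolding miss mem_Times_iff by eventually_elim force
    then show ?thesis using a l p by (intro that[of "{a1<..<a2} \<times> {..<l}"]) (auto intro: open_Times)
  qed
qed

lemma plot_hits_open:
  assumes "open G" "limit_line \<inter> G \<noteq> {}"
  shows "\<forall>\<^sub>F x in whp M. plot_point x ` {2..k (fst x)} \<inter> G \<noteq> {}"
proof -
  obtain t where t: "1 \<le> t" "(t, t / (\<alpha> - 1)) \<in> G" using assms(2) by (auto simp: limit_line_def)
  obtain A B where AB: "open A" "open B" "t \<in> A" "t / (\<alpha> - 1) \<in> B" "A \<times> B \<subseteq> G"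
    using assms(1) t(2) by (auto elim: open_prod_elim)
  obtain e where e: "0 < e" "ball (t / (\<alpha> - 1)) e \<subseteq> B" using AB openE by blast
  obtain a1 a2 where a: "a1 < t" "t < a2"
      "\<forall>\<^sub>F x in whp M. \<forall>i. a1 < fst (plot_point x i) \<and> fst (plot_point x i) < a2 \<longrightarrow>
        t / (\<alpha> - 1) - e < snd (plot_point x i) \<and> snd (plot_point x i) < t / (\<alpha> - 1) + e"
    using plot_points_near_line[OF t(1), of "t / (\<alpha> - 1) - e" "t / (\<alpha> - 1) + e"] e(1) by auto
  obtain e' where e': "0 < e'" "ball t e' \<subseteq> A" using AB openE by blast
  define d where "d = min a2 (t + e')"
  have "t < d" using a e' by (simp add: d_def)
  from plot_point_in_window[OF t(1) this] a(3) show ?thesis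
  proof eventually_elim
    case (elim x)
    obtain i where i: "i \<in> {2..k (fst x)}" "t < fst (plot_point x i) \<and> fst (plot_point x i) < d"
      using elim(1) by (rule bexE)
    have "fst (plot_point x i) \<in> A" using i(2) e'(2) by (auto simp: d_def dist_real_def subset_iff)
    moreover have "a1 < fst (plot_point x i) \<and> fst (plot_point x i) < a2" using i(2) a by (auto simp: d_def)
    then have "snd (plot_point x i) \<in> ball (t / (\<alpha> - 1)) e"
      using elim(2) by (auto simp: dist_real_def abs_less_iff)
    ultimately have "plot_point x i \<in> A \<times> B" using e(2) unfolding mem_Times_iff by blast
    then have "plot_point x i \<in> G" by (rule subsetD[OF AB(5)])
    then show ?case using i(1) by blast
  qed
qed

text \<open>
  It suffices to treat subbasic sets, since the events of a filter are closed under finite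
  intersections. Missing a compact set follows from missing neighbourhoods of its points by passing
  to a finite subcover.
\<close>

lemma plot_in_fell_neighbourhood:
  assumes "openin fell_topology \<U>" "limit_line \<in> \<U>"
  shows "\<forall>\<^sub>F x in whp M. plot_point x ` {2..k (fst x)} \<in> \<U>"
  using openin_topology_generated_by[OF assms(1)[unfolded fell_topology_def]] assms(2)
proof (induction \<U> rule: generate_topology_on.induct)
  case (Int \<U> \<V>)
  then show ?case by (auto intro: eventually_conj)
next
  case (UN \<K>)
  then obtain \<U> where "\<U> \<in> \<K>" "limit_line \<in> \<U>" by blast
  then show ?case using UN.IH[of \<U>] by (auto elim: eventually_mono)
next
  case (Basis \<U>)
  have cl: "closed (plot_point x ` {2..k (fst x)})" for x
    by (intro finite_imp_closed) simp
  from Basis consider K where "compact K" "\<U> = {F. closed F \<and> F \<inter> K = {}}"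
    | G where "open G" "\<U> = {F. closed F \<and> F \<inter> G \<noteq> {}}" by auto
  then show ?case
  proof cases
    case 1
    have "\<forall>p\<in>K. \<exists>V. open V \<and> p \<in> V \<and> (\<forall>\<^sub>F x in whp M. plot_point x ` {2..k (fst x)} \<inter> V = {})"
    proof
      fix p assume "p \<in> K"
      then have "p \<notin> limit_line" using 1 Basis.prems by auto
      then show "\<exists>V. open V \<and> p \<in> V \<and> (\<forall>\<^sub>F x in whp M. plot_point x ` {2..k (fst x)} \<inter> V = {})"
        by (rule plot_misses_neighbourhood) blast
    qed
    from bchoice[OF this] obtain V where V: "\<forall>p\<in>K. open (V p) \<and> p \<in> V p \<and>
        (\<forall>\<^sub>F x in whp M. plot_point x ` {2..k (fst x)} \<inter> V p = {})" by (rule exE)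
    obtain D where D: "D \<subseteq> K" "finite D" "K \<subseteq> (\<Union>p\<in>D. V p)"
      using compactE_image[OF 1(1), of K V] V by blast
    have "\<forall>\<^sub>F x in whp M. \<forall>p\<in>D. plot_point x ` {2..k (fst x)} \<inter> V p = {}"
      using D V by (intro eventually_ball_finite) auto
    then show ?thesis
    proof eventually_elim
      case (elim x)
      then have "plot_point x ` {2..k (fst x)} \<inter> K = {}" using D(3) by blast
      then show ?case using cl 1(2) by simp
    qed
  next
    case 2
    then have "limit_line \<inter> G \<noteq> {}" using Basis.prems by simp
    from plot_hits_open[OF 2(1) this] show ?thesis unfolding 2(2) by (simp add: cl)
  qed
qed simp

end

section \<open>The limit theorem\<close>

text \<open>
  For a constant limit, convergence in probability for any compatible metric only asks that the random elements
  eventually lie in each neighbourhood of the limit with high probability. The choice of the metric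
  disappears, as its balls are among these neighbourhoods.
\<close>

lemma converges_in_prob_constI:
  assumes "prob_space M" "metrizable_space T" "z \<in> topspace T"
    and "\<And>n. Y n \<in> measurable M (borel_sigma T)"
    and "\<And>U. openin T U \<Longrightarrow> z \<in> U \<Longrightarrow> \<forall>\<^sub>F x in whp M. Y (fst x) (snd x) \<in> U"
  shows "converges_in_prob M T Y (\<lambda>_. z)"
  unfolding converges_in_prob_def
proof (intro conjI allI impI)
  interpret prob_space M by fact
  show "Y n \<in> measurable M (borel_sigma T)" for n by fact
  show "(\<lambda>_. z) \<in> measurable M (borel_sigma T)"
    using assms(3) by (intro measurable_borel_sigmaI) auto
  show "metrizable_space T" by fact
  fix d :: "'b \<Rightarrow> 'b \<Rightarrow> real" and \<epsilon> :: real
  assume d: "Metric_space (topspace T) d \<and> Metric_space.mtopology (topspace T) d = T" and \<epsilon>: "0 < \<epsilon>"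
  interpret Metric_space "topspace T" d using d by blast
  have "openin T (mball z \<epsilon>)" using openin_mball[of z \<epsilon>] d by simp
  then have "\<forall>\<^sub>F x in whp M. Y (fst x) (snd x) \<in> mball z \<epsilon>"
    by (rule assms(5)) (use assms(3) \<epsilon> in simp)
  then have "\<forall>\<^sub>F x in whp M. \<not> \<epsilon> < d (Y (fst x) (snd x)) z"
    by eventually_elim (auto simp: commute)
  from measure_bad_tendsto_0[OF this]
  show "(\<lambda>n. measure M {\<omega> \<in> space M. \<epsilon> < d (Y n \<omega>) z}) \<longlonglongrightarrow> 0" by simp
qed

theorem theorem3p2:
  fixes \<xi> :: real and M :: "'a measure" and X :: "nat \<Rightarrow> 'a \<Rightarrow> real"
    and F :: "real \<Rightarrow> real" and k :: "nat \<Rightarrow> nat"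
  assumes "0 < \<xi>" "\<xi> < 1"
    and "prob_space M"
    and "\<And>n. n \<ge> 1 \<Longrightarrow> X n \<in> borel_measurable M"
    and "prob_space.indep_vars M (\<lambda>_. borel) X {1..}"
    and "\<And>n. n \<ge> 1 \<Longrightarrow> cdf (distr M borel (X n)) = F"
    and "regularly_varying (\<lambda>x. 1 - F x) (- 1 / \<xi>)"
    and "\<And>n. n \<ge> 1 \<Longrightarrow> k n > 0"
    and "filterlim k at_top sequentially"
    and "(\<lambda>n. real (k n) / real n) \<longlonglongrightarrow> 0"
  shows "converges_in_prob M fell_topology
           (\<lambda>n \<omega>. mean_excess_plot (\<lambda>j. X j \<omega>) n (k n))
           (\<lambda>\<omega>. {(t, \<xi> / (1 - \<xi>) * t) | t. t \<ge> 1})"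
proof -
  interpret prob_space M by fact
  interpret iid_heavy_tail M X "\<lambda>x. 1 - F x" "1 / \<xi>" k
  proof
    fix n :: nat and t :: real assume n: "n \<ge> 1"
    have [measurable]: "X n \<in> borel_measurable M" using assms(4)[OF n] .
    have "{\<omega> \<in> space M. t < X n \<omega>} = space M - {\<omega> \<in> space M. X n \<omega> \<le> t}" by auto
    moreover have "F t = prob {\<omega> \<in> space M. X n \<omega> \<le> t}"
      unfolding assms(6)[OF n, symmetric] cdf_def
      by (subst measure_distr) (auto intro!: arg_cong[of _ _ prob])
    ultimately show "prob {\<omega> \<in> space M. t < X n \<omega>} = 1 - F t"
      using prob_compl[of "{\<omega> \<in> space M. X n \<omega> \<le> t}"] by simp
  qed (use assms in auto)
  \<comment> \<open>with \<open>\<alpha> = 1 / \<xi>\<close> the slope \<open>\<xi> / (1 - \<xi>)\<close> is \<open>1 / (\<alpha> - 1)\<close>\<close>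
  have slope: "\<xi> / (1 - \<xi>) * t = t / (1 / \<xi> - 1)" for t
    using assms(1,2) by (simp add: field_simps)
  have line: "{(t, \<xi> / (1 - \<xi>) * t) | t. t \<ge> 1} = limit_line"
    unfolding limit_line_def slope ..
  have plot: "mean_excess_plot (\<lambda>j. X j \<omega>) n (k n) = plot_point (n, \<omega>) ` {2..k n}" for n \<omega>
    by (simp add: mean_excess_plot_eq plot_point_def)
  have "closed limit_line"
  proof -
    have "limit_line = (\<lambda>t. (t, t / (1 / \<xi> - 1))) ` {1..}" by (auto simp: limit_line_def)
    also have "\<dots> = {p. 1 \<le> fst p \<and> snd p = fst p / (1 / \<xi> - 1)}" by (auto simp: image_iff)
    also have "closed \<dots>"
      by (intro closed_Collect_conj closed_Collect_le closed_Collect_eq continuous_intros)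
        (use assms(1,2) in auto)
    finally show ?thesis .
  qed
  then show ?thesis
    unfolding line
    by (intro converges_in_prob_constI assms(3) metrizable_fell_topology measurable_mean_excess_plot)
       (auto simp: topspace_fell_topology plot dest: plot_in_fell_neighbourhood)
qed

end
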